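(* Let $\gamma>0$ and let $U\colon\mathbf{FinSet}/[2]\to\mathbf{FinSet}$ be the forgetful functor. Gradient ascent-descent gives a monoidal natural transformation $\mathsf{ga}\text{-}\mathsf{d}^\gamma\colon\mathsf{DiffSaddle}\Rightarrow\mathsf{Dynam}_D\circ U$ whose component at $\tau\colon N\to[2]$, $\mathsf{ga}\text{-}\mathsf{d}^\gamma_\tau\colon\mathsf{DiffSaddle}(\tau)\to\mathsf{Dynam}_D(N)$, is defined by $$\mathsf{ga}\text{-}\mathsf{d}^\gamma_\tau(f)(x)_i=\begin{cases}x_i-\gamma\nabla f(x)_i & \tau(i)=1\\ x_i+\gamma\nabla f(x)_i & \tau(i)=2\end{cases}$$ for all $x\in\mathbb{R}^N$ and $i\in N$.
   Context: $[2]=\{1,2\}$. $\mathbf{FinSet}/[2]$ is the slice category: objects are functions $\tau\colon N\to[2]$ from finite sets, morphisms $\tau_1\to\tau_2$ are functions $\phi$ between the domains with $\tau_2\circ\phi=\tau_1$; the monoidal product is the coproduct ($N+M$ labelled by the copairing $[\tau_1,\tau_2]$), unit $\emptyset\to[2]$. $U$ sends $\tau\colon N\to[2]$ to $N$ and a morphism to its underlying function. $(\mathbf{FinSet},+)$ has disjoint union and $(\mathbf{Set},\times)$ Cartesian product. For a finite set $N$, $\mathbb{R}^N$ is the vector space of functions $N\to\mathbb{R}$; for $\phi\colon N\to M$, $\phi^*\colon\mathbb{R}^M\to\mathbb{R}^N$ is $\phi^*(y)_i=y_{\phi(i)}$ and $\phi_*\colon\mathbb{R}^N\to\mathbb{R}^M$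 is $\phi_*(x)_j=\sum_{i\in\phi^{-1}(j)}x_i$. $\iota_N,\iota_M$ are the inclusions of $N,M$ into $N+M$. $\mathsf{DiffSaddle}\colon(\mathbf{FinSet}/[2],+)\to(\mathbf{Set},\times)$ is the lax symmetric monoidal functor sending $\tau\colon N\to[2]$ to the set of $C^1$ functions $f\colon\mathbb{R}^N\to\mathbb{R}$ that are convex in the coordinates labelled $1$ (for any fixed values of the coordinates labelled $2$) and concave in the coordinates labelled $2$ (for any fixed values of the coordinates labelled $1$); a morphism $\phi$ acts by $f\mapsto f\circ\phi^*$; the product comparison is $(f,g)\mapsto f\circ\iota_N^*+g\circ\iota_M^*$; the unit comparison picks the zero function. $\mathsf{Dynam}_D\colon(\mathbf{FinSet},+)\to(\mathbf{Set},\times)$ is the lax symmetric monoidal functor with $\mathsf{Dynam}_D(N)$ the set of maps $\upsilon\colon\mathbb{R}^N\to\mathbb{R}^N$; $\mathsf{Dynam}_D(\phi)(\upsilon)=\mathrm{id}_{\mathbb{R}^M}+\phi_*\circ(\upsilon-\mathrm{id}_{\mathbb{R}^N})\circ\phi^*$ for $\phi\colon N\to M$; product comparison $(\upsilon,\rho)\mapsto\iota_{N*}\circ\upsilon\circ\iota_N^*+\iota_{M*}\circ\rho\circ\iota_M^*$; unit comparison the unique map $\{*\}\to\mathsf{Dynam}_D(\emptyset)$. *)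

theory Defs
  imports "HOL-Analysis.Analysis"
begin

record ('o, 'm) cat =
  Obj :: "'o set"
  Arr :: "'m set"
  Dom :: "'m \<Rightarrow> 'o"
  Cod :: "'m \<Rightarrow> 'o"
  Ident :: "'o \<Rightarrow> 'm"
  Comp :: "'m \<Rightarrow> 'm \<Rightarrow> 'm"  (infixl \<open>\<odot>\<index>\<close> 70)

text \<open>Composition is written in applicative order: \<open>g \<odot> f\<close> is ``first \<open>f\<close>, then \<open>g\<close>''.\<close>

record ('o, 'm) smcat = "('o, 'm) cat" +
  Tensor :: "'o \<Rightarrow> 'o \<Rightarrow> 'o"  (infixl \<open>\<oplus>\<index>\<close> 65)
  TensorArr :: "'m \<Rightarrow> 'm \<Rightarrow> 'm"
  Unit :: "'o"
  Assoc :: "'o \<Rightarrow> 'o \<Rightarrow> 'o \<Rightarrow> 'm"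
  LUnit :: "'o \<Rightarrow> 'm"
  RUnit :: "'o \<Rightarrow> 'm"
  Braid :: "'o \<Rightarrow> 'o \<Rightarrow> 'm"

definition hom :: "('o, 'm, 'z) cat_scheme \<Rightarrow> 'o \<Rightarrow> 'o \<Rightarrow> 'm set" where
  "hom C a b = {f \<in> Arr C. Dom C f = a \<and> Cod C f = b}"

definition is_iso :: "('o, 'm, 'z) cat_scheme \<Rightarrow> 'm \<Rightarrow> bool" where
  "is_iso C f \<longleftrightarrow> f \<in> Arr C \<and>
     (\<exists>g \<in> hom C (Cod C f) (Dom C f).
        g \<odot>\<^bsub>C\<^esub> f = Ident C (Dom C f) \<and> f \<odot>\<^bsub>C\<^esub> g = Ident C (Cod C f))"

locale category =
  fixes C :: "('o, 'm, 'z) cat_scheme" (structure)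
  assumes dom_obj: "f \<in> Arr C \<Longrightarrow> Dom C f \<in> Obj C"
    and cod_obj: "f \<in> Arr C \<Longrightarrow> Cod C f \<in> Obj C"
    and ident_hom: "a \<in> Obj C \<Longrightarrow> Ident C a \<in> hom C a a"
    and comp_hom: "\<lbrakk>f \<in> hom C a b; g \<in> hom C b c\<rbrakk> \<Longrightarrow> g \<odot> f \<in> hom C a c"
    and ident_comp: "f \<in> hom C a b \<Longrightarrow> Ident C b \<odot> f = f"
    and comp_ident: "f \<in> hom C a b \<Longrightarrow> f \<odot> Ident C a = f"
    and comp_assoc: "\<lbrakk>f \<in> hom C a b; g \<in> hom C b c; h \<in> hom C c d\<rbrakk>
          \<Longrightarrow> h \<odot> (g \<odot> f) = (h \<odot> g) \<odot> f"

locale symmetric_monoidal_category = category C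
  for C :: "('o, 'm, 'z) smcat_scheme" (structure) +
  assumes unit_obj: "Unit C \<in> Obj C"
    and tensor_obj: "\<lbrakk>a \<in> Obj C; b \<in> Obj C\<rbrakk> \<Longrightarrow> a \<oplus> b \<in> Obj C"
    and tensor_hom: "\<lbrakk>f \<in> hom C a a'; g \<in> hom C b b'\<rbrakk>
          \<Longrightarrow> TensorArr C f g \<in> hom C (a \<oplus> b) (a' \<oplus> b')"
    and tensor_ident: "\<lbrakk>a \<in> Obj C; b \<in> Obj C\<rbrakk>
          \<Longrightarrow> TensorArr C (Ident C a) (Ident C b) = Ident C (a \<oplus> b)"
    and tensor_comp: "\<lbrakk>f \<in> hom C a a'; f' \<in> hom C a' a''; g \<in> hom C b b'; g' \<in> hom C b' b''\<rbrakk>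
          \<Longrightarrow> TensorArr C (f' \<odot> f) (g' \<odot> g) = TensorArr C f' g' \<odot> TensorArr C f g"
    and assoc_hom: "\<lbrakk>a \<in> Obj C; b \<in> Obj C; c \<in> Obj C\<rbrakk>
          \<Longrightarrow> Assoc C a b c \<in> hom C ((a \<oplus> b) \<oplus> c) (a \<oplus> (b \<oplus> c))"
    and assoc_iso: "\<lbrakk>a \<in> Obj C; b \<in> Obj C; c \<in> Obj C\<rbrakk> \<Longrightarrow> is_iso C (Assoc C a b c)"
    and assoc_natural: "\<lbrakk>f \<in> hom C a a'; g \<in> hom C b b'; h \<in> hom C c c'\<rbrakk>
          \<Longrightarrow> Assoc C a' b' c' \<odot> TensorArr C (TensorArr C f g) h
             = TensorArr C f (TensorArr C g h) \<odot> Assoc C a b c"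
    and lunit_hom: "a \<in> Obj C \<Longrightarrow> LUnit C a \<in> hom C (Unit C \<oplus> a) a"
    and lunit_iso: "a \<in> Obj C \<Longrightarrow> is_iso C (LUnit C a)"
    and lunit_natural: "f \<in> hom C a b
          \<Longrightarrow> LUnit C b \<odot> TensorArr C (Ident C (Unit C)) f = f \<odot> LUnit C a"
    and runit_hom: "a \<in> Obj C \<Longrightarrow> RUnit C a \<in> hom C (a \<oplus> Unit C) a"
    and runit_iso: "a \<in> Obj C \<Longrightarrow> is_iso C (RUnit C a)"
    and runit_natural: "f \<in> hom C a b
          \<Longrightarrow> RUnit C b \<odot> TensorArr C f (Ident C (Unit C)) = f \<odot> RUnit C a"
    and braid_hom: "\<lbrakk>a \<in> Obj C; b \<in> Obj C\<rbrakk> \<Longrightarrow> Braid C a b \<in> hom C (a \<oplus> b) (b \<oplus> a)"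
    and braid_natural: "\<lbrakk>f \<in> hom C a a'; g \<in> hom C b b'\<rbrakk>
          \<Longrightarrow> Braid C a' b' \<odot> TensorArr C f g = TensorArr C g f \<odot> Braid C a b"
    and braid_symmetry: "\<lbrakk>a \<in> Obj C; b \<in> Obj C\<rbrakk>
          \<Longrightarrow> Braid C b a \<odot> Braid C a b = Ident C (a \<oplus> b)"
    and triangle: "\<lbrakk>a \<in> Obj C; b \<in> Obj C\<rbrakk>
          \<Longrightarrow> TensorArr C (Ident C a) (LUnit C b) \<odot> Assoc C a (Unit C) b
             = TensorArr C (RUnit C a) (Ident C b)"
    and pentagon: "\<lbrakk>a \<in> Obj C; b \<in> Obj C; c \<in> Obj C; d \<in> Obj C\<rbrakk>
          \<Longrightarrow> TensorArr C (Ident C a) (Assoc C b c d) \<odot> Assoc C a (b \<oplus> c) d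
                \<odot> TensorArr C (Assoc C a b c) (Ident C d)
             = Assoc C a b (c \<oplus> d) \<odot> Assoc C (a \<oplus> b) c d"
    and hexagon: "\<lbrakk>a \<in> Obj C; b \<in> Obj C; c \<in> Obj C\<rbrakk>
          \<Longrightarrow> Assoc C b c a \<odot> Braid C a (b \<oplus> c) \<odot> Assoc C a b c
             = TensorArr C (Ident C b) (Braid C a c) \<odot> Assoc C b a c
                \<odot> TensorArr C (Braid C a b) (Ident C c)"

text \<open>
  The target is always the category of sets with its Cartesian product, whose associators,
  unitors and braiding are the evident re-bracketings, projections and swap of tuples. The
  value of a functor at an object is a set \<open>SetObj F a\<close> of elements of a type \<open>'x\<close>; an arrow
  acts as a function on the set at its domain, and only its values there matter.
\<close>

record ('o, 'm, 'x) set_functor =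
  SetObj :: "'o \<Rightarrow> 'x set"
  SetArr :: "'m \<Rightarrow> 'x \<Rightarrow> 'x"
  ProdComparison :: "'o \<Rightarrow> 'o \<Rightarrow> 'x \<times> 'x \<Rightarrow> 'x"
  UnitComparison :: "unit \<Rightarrow> 'x"

locale lax_symmetric_monoidal_functor = symmetric_monoidal_category C
  for C :: "('o, 'm, 'z) smcat_scheme" (structure) +
  fixes F :: "('o, 'm, 'x) set_functor"
  assumes arr_map: "f \<in> hom C a b \<Longrightarrow> SetArr F f \<in> SetObj F a \<rightarrow> SetObj F b"
    and arr_ident: "\<lbrakk>a \<in> Obj C; x \<in> SetObj F a\<rbrakk> \<Longrightarrow> SetArr F (Ident C a) x = x"
    and arr_comp: "\<lbrakk>f \<in> hom C a b; g \<in> hom C b c; x \<in> SetObj F a\<rbrakk>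
          \<Longrightarrow> SetArr F (g \<odot> f) x = SetArr F g (SetArr F f x)"
    and prod_map: "\<lbrakk>a \<in> Obj C; b \<in> Obj C\<rbrakk>
          \<Longrightarrow> ProdComparison F a b \<in> SetObj F a \<times> SetObj F b \<rightarrow> SetObj F (a \<oplus> b)"
    and unit_map: "UnitComparison F \<in> {()} \<rightarrow> SetObj F (Unit C)"
    and prod_natural: "\<lbrakk>f \<in> hom C a a'; g \<in> hom C b b'; x \<in> SetObj F a; y \<in> SetObj F b\<rbrakk>
          \<Longrightarrow> SetArr F (TensorArr C f g) (ProdComparison F a b (x, y))
             = ProdComparison F a' b' (SetArr F f x, SetArr F g y)"
    and associativity: "\<lbrakk>a \<in> Obj C; b \<in> Obj C; c \<in> Obj C;
            x \<in> SetObj F a; y \<in> SetObj F b; z \<in> SetObj F c\<rbrakk>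
          \<Longrightarrow> SetArr F (Assoc C a b c)
                (ProdComparison F (a \<oplus> b) c (ProdComparison F a b (x, y), z))
             = ProdComparison F a (b \<oplus> c) (x, ProdComparison F b c (y, z))"
    and left_unitality: "\<lbrakk>a \<in> Obj C; x \<in> SetObj F a\<rbrakk>
          \<Longrightarrow> SetArr F (LUnit C a) (ProdComparison F (Unit C) a (UnitComparison F (), x)) = x"
    and right_unitality: "\<lbrakk>a \<in> Obj C; x \<in> SetObj F a\<rbrakk>
          \<Longrightarrow> SetArr F (RUnit C a) (ProdComparison F a (Unit C) (x, UnitComparison F ())) = x"
    and symmetry: "\<lbrakk>a \<in> Obj C; b \<in> Obj C; x \<in> SetObj F a; y \<in> SetObj F b\<rbrakk>
          \<Longrightarrow> SetArr F (Braid C a b) (ProdComparison F a b (x, y))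
             = ProdComparison F b a (y, x)"

locale monoidal_natural_transformation =
  F: lax_symmetric_monoidal_functor C F + G: lax_symmetric_monoidal_functor C G
  for C :: "('o, 'm, 'z) smcat_scheme" (structure)
    and F :: "('o, 'm, 'x) set_functor"
    and G :: "('o, 'm, 'y) set_functor" +
  fixes \<alpha> :: "'o \<Rightarrow> 'x \<Rightarrow> 'y"
  assumes component: "a \<in> Obj C \<Longrightarrow> \<alpha> a \<in> SetObj F a \<rightarrow> SetObj G a"
    and natural: "\<lbrakk>f \<in> hom C a b; x \<in> SetObj F a\<rbrakk>
          \<Longrightarrow> \<alpha> b (SetArr F f x) = SetArr G f (\<alpha> a x)"
    and monoidal_prod: "\<lbrakk>a \<in> Obj C; b \<in> Obj C; x \<in> SetObj F a; y \<in> SetObj F b\<rbrakk>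
          \<Longrightarrow> \<alpha> (a \<oplus> b) (ProdComparison F a b (x, y)) = ProdComparison G a b (\<alpha> a x, \<alpha> b y)"
    and monoidal_unit: "\<alpha> (Unit C) (UnitComparison F ()) = UnitComparison G ()"

record ('o, 'm, 'p, 'n) functor_data =
  ObjMap :: "'o \<Rightarrow> 'p"
  ArrMap :: "'m \<Rightarrow> 'n"

locale strict_symmetric_monoidal_functor =
  C: symmetric_monoidal_category C + D: symmetric_monoidal_category D
  for C :: "('o, 'm, 'y) smcat_scheme" and D :: "('p, 'n, 'z) smcat_scheme" +
  fixes U :: "('o, 'm, 'p, 'n) functor_data"
  assumes map_obj: "a \<in> Obj C \<Longrightarrow> ObjMap U a \<in> Obj D"
    and map_hom: "f \<in> hom C a b \<Longrightarrow> ArrMap U f \<in> hom D (ObjMap U a) (ObjMap U b)"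
    and map_ident: "a \<in> Obj C \<Longrightarrow> ArrMap U (Ident C a) = Ident D (ObjMap U a)"
    and map_comp: "\<lbrakk>f \<in> hom C a b; g \<in> hom C b c\<rbrakk>
          \<Longrightarrow> ArrMap U (g \<odot>\<^bsub>C\<^esub> f) = ArrMap U g \<odot>\<^bsub>D\<^esub> ArrMap U f"
    and map_tensor: "\<lbrakk>a \<in> Obj C; b \<in> Obj C\<rbrakk>
          \<Longrightarrow> ObjMap U (a \<oplus>\<^bsub>C\<^esub> b) = ObjMap U a \<oplus>\<^bsub>D\<^esub> ObjMap U b"
    and map_tensor_arr: "\<lbrakk>f \<in> Arr C; g \<in> Arr C\<rbrakk>
          \<Longrightarrow> ArrMap U (TensorArr C f g) = TensorArr D (ArrMap U f) (ArrMap U g)"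
    and map_unit: "ObjMap U (Unit C) = Unit D"
    and map_assoc: "\<lbrakk>a \<in> Obj C; b \<in> Obj C; c \<in> Obj C\<rbrakk>
          \<Longrightarrow> ArrMap U (Assoc C a b c) = Assoc D (ObjMap U a) (ObjMap U b) (ObjMap U c)"
    and map_lunit: "a \<in> Obj C \<Longrightarrow> ArrMap U (LUnit C a) = LUnit D (ObjMap U a)"
    and map_runit: "a \<in> Obj C \<Longrightarrow> ArrMap U (RUnit C a) = RUnit D (ObjMap U a)"
    and map_braid: "\<lbrakk>a \<in> Obj C; b \<in> Obj C\<rbrakk>
          \<Longrightarrow> ArrMap U (Braid C a b) = Braid D (ObjMap U a) (ObjMap U b)"

text \<open>
  The composite \<open>F \<circ> U\<close> of a lax functor with a strict one: as \<open>U\<close> preserves tensor and unit on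
  the nose, the comparisons of the composite are those of \<open>F\<close> at the images under \<open>U\<close>.
\<close>

definition precompose ::
  "('p, 'n, 'x) set_functor \<Rightarrow> ('o, 'm, 'p, 'n) functor_data \<Rightarrow> ('o, 'm, 'x) set_functor" where
  "precompose F U =
    \<lparr>SetObj = (\<lambda>a. SetObj F (ObjMap U a)),
     SetArr = (\<lambda>f. SetArr F (ArrMap U f)),
     ProdComparison = (\<lambda>a b. ProdComparison F (ObjMap U a) (ObjMap U b)),
     UnitComparison = UnitComparison F\<rparr>"

text \<open>
  The finite sets are the finite subsets of a type closed under binary disjoint unions, so that
  all coproducts, including the iterated ones of the coherence laws, live in one category. Every
  finite set of elements of an arbitrary type \<open>'a\<close> is an object, via \<open>Atom\<close>. Functions between
  finite sets are extensional, so that equality of arrows is equality of functions.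
\<close>

datatype 'a tagged = Atom 'a | InL "'a tagged" | InR "'a tagged"

definition coprod :: "'a tagged set \<Rightarrow> 'a tagged set \<Rightarrow> 'a tagged set" where
  "coprod N M = InL ` N \<union> InR ` M"

definition copair ::
  "'a tagged set \<Rightarrow> 'a tagged set \<Rightarrow> ('a tagged \<Rightarrow> 'b) \<Rightarrow> ('a tagged \<Rightarrow> 'b) \<Rightarrow> 'a tagged \<Rightarrow> 'b" where
  "copair N M f g = (\<lambda>k \<in> coprod N M. case k of Atom _ \<Rightarrow> undefined | InL i \<Rightarrow> f i | InR j \<Rightarrow> g j)"

definition coprod_fun ::
  "'a tagged set \<Rightarrow> 'a tagged set \<Rightarrow> ('a tagged \<Rightarrow> 'a tagged) \<Rightarrow> ('a tagged \<Rightarrow> 'a tagged)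
    \<Rightarrow> 'a tagged \<Rightarrow> 'a tagged" where
  "coprod_fun N M f g = copair N M (\<lambda>i. InL (f i)) (\<lambda>j. InR (g j))"

definition assoc_fun ::
  "'a tagged set \<Rightarrow> 'a tagged set \<Rightarrow> 'a tagged set \<Rightarrow> 'a tagged \<Rightarrow> 'a tagged" where
  "assoc_fun N M K =
     copair (coprod N M) K (copair N M InL (\<lambda>j. InR (InL j))) (\<lambda>k. InR (InR k))"

definition lunit_fun :: "'a tagged set \<Rightarrow> 'a tagged \<Rightarrow> 'a tagged" where
  "lunit_fun N = copair {} N (\<lambda>_. undefined) (\<lambda>i. i)"

definition runit_fun :: "'a tagged set \<Rightarrow> 'a tagged \<Rightarrow> 'a tagged" where
  "runit_fun N = copair N {} (\<lambda>i. i) (\<lambda>_. undefined)"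

definition braid_fun :: "'a tagged set \<Rightarrow> 'a tagged set \<Rightarrow> 'a tagged \<Rightarrow> 'a tagged" where
  "braid_fun N M = copair N M InR InL"

type_synonym 'a finset = "'a tagged set"
type_synonym 'a finset_arr = "'a finset \<times> ('a tagged \<Rightarrow> 'a tagged) \<times> 'a finset"

definition FinSet :: "('a finset, 'a finset_arr) smcat" where
  "FinSet =
    \<lparr>Obj = {N. finite N},
     Arr = {(N, \<phi>, M). finite N \<and> finite M \<and> \<phi> \<in> N \<rightarrow>\<^sub>E M},
     Dom = (\<lambda>(N, \<phi>, M). N),
     Cod = (\<lambda>(N, \<phi>, M). M),
     Ident = (\<lambda>N. (N, \<lambda>i\<in>N. i, N)),
     Comp = (\<lambda>(M', \<psi>, K) (N, \<phi>, M). (N, compose N \<psi> \<phi>, K)),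
     Tensor = coprod,
     TensorArr = (\<lambda>(N, \<phi>, M) (N', \<phi>', M').
        (coprod N N', coprod_fun N N' \<phi> \<phi>', coprod M M')),
     Unit = {},
     Assoc = (\<lambda>N M K. (coprod (coprod N M) K, assoc_fun N M K, coprod N (coprod M K))),
     LUnit = (\<lambda>N. (coprod {} N, lunit_fun N, N)),
     RUnit = (\<lambda>N. (coprod N {}, runit_fun N, N)),
     Braid = (\<lambda>N M. (coprod N M, braid_fun N M, coprod M N))\<rparr>"

type_synonym 'a labelled = "'a finset \<times> ('a tagged \<Rightarrow> nat)"
type_synonym 'a labelled_arr = "'a labelled \<times> ('a tagged \<Rightarrow> 'a tagged) \<times> 'a labelled"

fun labelled_coprod :: "'a labelled \<Rightarrow> 'a labelled \<Rightarrow> 'a labelled" where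
  "labelled_coprod (N, \<tau>) (M, \<sigma>) = (coprod N M, copair N M \<tau> \<sigma>)"

definition labelled_empty :: "'a labelled" where
  "labelled_empty = ({}, \<lambda>_. undefined)"

definition FinSet2 :: "('a labelled, 'a labelled_arr) smcat" where
  "FinSet2 =
    \<lparr>Obj = {(N, \<tau>). finite N \<and> \<tau> \<in> N \<rightarrow>\<^sub>E {1, 2}},
     Arr = {((N, \<tau>), \<phi>, (M, \<sigma>)). finite N \<and> finite M \<and> \<tau> \<in> N \<rightarrow>\<^sub>E {1, 2} \<and> \<sigma> \<in> M \<rightarrow>\<^sub>E {1, 2} \<and>
        \<phi> \<in> N \<rightarrow>\<^sub>E M \<and> compose N \<sigma> \<phi> = \<tau>},
     Dom = (\<lambda>(a, \<phi>, b). a),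
     Cod = (\<lambda>(a, \<phi>, b). b),
     Ident = (\<lambda>a. (a, \<lambda>i\<in>fst a. i, a)),
     Comp = (\<lambda>(b', \<psi>, c) (a, \<phi>, b). (a, compose (fst a) \<psi> \<phi>, c)),
     Tensor = labelled_coprod,
     TensorArr = (\<lambda>(a, \<phi>, b) (a', \<phi>', b').
        (labelled_coprod a a', coprod_fun (fst a) (fst a') \<phi> \<phi>', labelled_coprod b b')),
     Unit = labelled_empty,
     Assoc = (\<lambda>a b c. (labelled_coprod (labelled_coprod a b) c,
        assoc_fun (fst a) (fst b) (fst c), labelled_coprod a (labelled_coprod b c))),
     LUnit = (\<lambda>a. (labelled_coprod labelled_empty a, lunit_fun (fst a), a)),
     RUnit = (\<lambda>a. (labelled_coprod a labelled_empty, runit_fun (fst a), a)),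
     Braid = (\<lambda>a b. (labelled_coprod a b, braid_fun (fst a) (fst b), labelled_coprod b a))\<rparr>"

definition Forget :: "('a labelled, 'a labelled_arr, 'a finset, 'a finset_arr) functor_data" where
  "Forget = \<lparr>ObjMap = fst, ArrMap = (\<lambda>(a, \<phi>, b). (fst a, \<phi>, fst b))\<rparr>"

definition Rvec :: "'i set \<Rightarrow> ('i \<Rightarrow> real) set" where
  "Rvec N = N \<rightarrow>\<^sub>E UNIV"

definition pull :: "'i set \<Rightarrow> ('i \<Rightarrow> 'j) \<Rightarrow> ('j \<Rightarrow> real) \<Rightarrow> 'i \<Rightarrow> real" where
  "pull N \<phi> y = (\<lambda>i\<in>N. y (\<phi> i))"

definition push :: "'i set \<Rightarrow> 'j set \<Rightarrow> ('i \<Rightarrow> 'j) \<Rightarrow> ('i \<Rightarrow> real) \<Rightarrow> 'j \<Rightarrow> real" where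
  "push N M \<phi> x = (\<lambda>j\<in>M. \<Sum>i\<in>{i \<in> N. \<phi> i = j}. x i)"

definition vadd :: "'i set \<Rightarrow> ('i \<Rightarrow> real) \<Rightarrow> ('i \<Rightarrow> real) \<Rightarrow> 'i \<Rightarrow> real" where
  "vadd N x y = (\<lambda>i\<in>N. x i + y i)"

definition vdiff :: "'i set \<Rightarrow> ('i \<Rightarrow> real) \<Rightarrow> ('i \<Rightarrow> real) \<Rightarrow> 'i \<Rightarrow> real" where
  "vdiff N x y = (\<lambda>i\<in>N. x i - y i)"

definition has_partials :: "'i set \<Rightarrow> (('i \<Rightarrow> real) \<Rightarrow> real) \<Rightarrow> bool" where
  "has_partials N f \<longleftrightarrow>
     (\<forall>x \<in> Rvec N. \<forall>i \<in> N. (\<lambda>t. f (x(i := t))) differentiable (at (x i)))"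

definition grad :: "'i set \<Rightarrow> (('i \<Rightarrow> real) \<Rightarrow> real) \<Rightarrow> ('i \<Rightarrow> real) \<Rightarrow> 'i \<Rightarrow> real" where
  "grad N f x = (\<lambda>i\<in>N. deriv (\<lambda>t. f (x(i := t))) (x i))"

text \<open>The product topology below has \<open>Rvec N\<close> as its space; it is the usual topology of \<open>\<real>\<^sup>N\<close>.\<close>

definition C1 :: "'i set \<Rightarrow> (('i \<Rightarrow> real) \<Rightarrow> real) \<Rightarrow> bool" where
  "C1 N f \<longleftrightarrow> has_partials N f \<and>
     (\<forall>i \<in> N. continuous_map (product_topology (\<lambda>_. euclideanreal) N) euclideanreal
               (\<lambda>x. grad N f x i))"

text \<open>
  \<open>f\<close> is convex in the coordinates \<open>K \<subseteq> N\<close> for fixed values of the others: \<open>x\<close> and \<open>y\<close> below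
  have the same coordinates outside \<open>K\<close>.
\<close>

definition convex_in :: "'i set \<Rightarrow> 'i set \<Rightarrow> (('i \<Rightarrow> real) \<Rightarrow> real) \<Rightarrow> bool" where
  "convex_in N K f \<longleftrightarrow>
     (\<forall>x \<in> Rvec N. \<forall>y \<in> Rvec N. \<forall>t \<in> {0..1}. (\<forall>i \<in> N - K. x i = y i) \<longrightarrow>
        f (\<lambda>i\<in>N. (1 - t) * x i + t * y i) \<le> (1 - t) * f x + t * f y)"

definition concave_in :: "'i set \<Rightarrow> 'i set \<Rightarrow> (('i \<Rightarrow> real) \<Rightarrow> real) \<Rightarrow> bool" where
  "concave_in N K f \<longleftrightarrow> convex_in N K (\<lambda>x. - f x)"

definition saddle_functions :: "'a labelled \<Rightarrow> (('a tagged \<Rightarrow> real) \<Rightarrow> real) set" where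
  "saddle_functions = (\<lambda>(N, \<tau>).
     {f \<in> Rvec N \<rightarrow>\<^sub>E UNIV. C1 N f \<and>
        convex_in N {i \<in> N. \<tau> i = 1} f \<and> concave_in N {i \<in> N. \<tau> i = 2} f})"

definition DiffSaddle ::
  "('a labelled, 'a labelled_arr, ('a tagged \<Rightarrow> real) \<Rightarrow> real) set_functor" where
  "DiffSaddle =
    \<lparr>SetObj = saddle_functions,
     SetArr = (\<lambda>((N, \<tau>), \<phi>, (M, \<sigma>)). \<lambda>f. \<lambda>y\<in>Rvec M. f (pull N \<phi> y)),
     ProdComparison = (\<lambda>(N, \<tau>) (M, \<sigma>). \<lambda>(f, g).
        \<lambda>z\<in>Rvec (coprod N M). f (pull N InL z) + g (pull M InR z)),
     UnitComparison = (\<lambda>_. \<lambda>x\<in>Rvec {}. 0)\<rparr>"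

text \<open>The set of self-maps of \<open>\<real>\<^sup>\<emptyset>\<close>, a one-point space, has the identity as its only element.\<close>

definition DynamD ::
  "('a finset, 'a finset_arr, ('a tagged \<Rightarrow> real) \<Rightarrow> ('a tagged \<Rightarrow> real)) set_functor" where
  "DynamD =
    \<lparr>SetObj = (\<lambda>N. Rvec N \<rightarrow>\<^sub>E Rvec N),
     SetArr = (\<lambda>(N, \<phi>, M). \<lambda>\<upsilon>. \<lambda>y\<in>Rvec M.
        vadd M y (push N M \<phi> (vdiff N (\<upsilon> (pull N \<phi> y)) (pull N \<phi> y)))),
     ProdComparison = (\<lambda>N M. \<lambda>(\<upsilon>, \<rho>). \<lambda>z\<in>Rvec (coprod N M).
        vadd (coprod N M)
          (push N (coprod N M) InL (\<upsilon> (pull N InL z)))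
          (push M (coprod N M) InR (\<rho> (pull M InR z)))),
     UnitComparison = (\<lambda>_. \<lambda>x\<in>Rvec {}. x)\<rparr>"

text \<open>Labels are only \<open>1\<close> or \<open>2\<close>, so the \<open>else\<close> branch is the ascent step at label \<open>2\<close>.\<close>

definition gad ::
  "real \<Rightarrow> 'a labelled \<Rightarrow> (('a tagged \<Rightarrow> real) \<Rightarrow> real) \<Rightarrow> ('a tagged \<Rightarrow> real) \<Rightarrow> ('a tagged \<Rightarrow> real)"
  where
  "gad \<gamma> = (\<lambda>(N, \<tau>). \<lambda>f. \<lambda>x\<in>Rvec N. \<lambda>i\<in>N.
     if \<tau> i = 1 then x i - \<gamma> * grad N f x i else x i + \<gamma> * grad N f x i)"

end

theory Submission
  imports Defs
begin

text \<open>
  Both \<open>DiffSaddle\<close> and \<open>DynamD\<close> are functors into commutative monoids in disguise, and this is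
  the reason why all the monoidal structure in the statement exists. Saddle functions are added
  pointwise. Self-maps of \<open>\<real>\<^sup>N\<close> are added through their increments \<open>\<upsilon> - id\<close>: the sum of
  \<open>\<upsilon>\<close> and \<open>\<rho>\<close> is \<open>\<upsilon> + \<rho> - id\<close>, and the identity is the neutral element. In terms of
  increments, \<open>DynamD\<close> sends \<open>\<phi>\<close> to the additive map \<open>\<delta> \<mapsto> \<phi>\<^sub>* \<circ> \<delta> \<circ> \<phi>\<^sup>*\<close>. In both cases the
  product comparison is \<open>(x, y) \<mapsto> F \<iota>\<^sub>N x + F \<iota>\<^sub>M y\<close> and the unit comparison is zero.

  For any functor to commutative monoids on a category with such inclusions, these comparisons
  form a lax symmetric monoidal structure: every axiom becomes an identity between composites of
  structure maps with inclusions (locale \<open>commutative_monoid_valued_functor\<close>). A natural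
  transformation between two such functors is monoidal as soon as its components are monoid
  homomorphisms (\<open>monoidal_natural_transformationI\<close>).

  What remains specific to gradient ascent-descent is that it turns sums of functions into sums
  of increments, which is linearity of the gradient, and that it is natural. Naturality is the
  chain rule \<open>\<nabla>(f \<circ> \<phi>\<^sup>*) = \<phi>\<^sub>* \<circ> \<nabla>f \<circ> \<phi>\<^sup>*\<close> (\<open>C1_pull\<close>): moving the \<open>j\<close>-th coordinate of \<open>y\<close> moves
  simultaneously all coordinates of \<open>\<phi>\<^sup>* y\<close> in the fibre over \<open>j\<close>, and since morphisms preserve
  labels, the coordinates in one fibre all share the sign of \<open>j\<close>. The chain rule needs
  differentiability along diagonals, which follows from continuity of the partial derivatives
  (\<open>C1_diagonal_derivative\<close>).
\<close>

section \<open>Finite sets under disjoint union\<close>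

lemma InL_in_coprod [simp]: "InL i \<in> coprod N M \<longleftrightarrow> i \<in> N"
  and InR_in_coprod [simp]: "InR i \<in> coprod N M \<longleftrightarrow> i \<in> M"
  and Atom_in_coprod [simp]: "Atom a \<notin> coprod N M"
  by (auto simp: coprod_def)

lemma finite_coprod [simp]: "finite N \<Longrightarrow> finite M \<Longrightarrow> finite (coprod N M)"
  by (simp add: coprod_def)

lemma coprod_cases:
  assumes "k \<in> coprod N M"
  obtains i where "i \<in> N" "k = InL i" | j where "j \<in> M" "k = InR j"
  using assms by (auto simp: coprod_def)

lemma copair_InL [simp]: "i \<in> N \<Longrightarrow> copair N M f g (InL i) = f i"
  and copair_InR [simp]: "j \<in> M \<Longrightarrow> copair N M f g (InR j) = g j"
  and copair_outside [simp]: "k \<notin> coprod N M \<Longrightarrow> copair N M f g k = undefined"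
  by (auto simp: copair_def)

lemma copair_PiE [simp]:
  "copair N M f g \<in> coprod N M \<rightarrow>\<^sub>E K \<longleftrightarrow> (\<forall>i\<in>N. f i \<in> K) \<and> (\<forall>j\<in>M. g j \<in> K)"
  by (auto simp: PiE_iff extensional_def elim!: coprod_cases
      dest: bspec[of _ _ "InL _"] bspec[of _ _ "InR _"])

lemma copair_extensional [simp]: "copair N M f g \<in> extensional (coprod N M)"
  by (simp add: extensional_def)

lemma coprod_fun_extensional [simp]: "coprod_fun N M f g \<in> extensional (coprod N M)"
  by (simp add: coprod_fun_def)

lemmas structure_funs = coprod_fun_def assoc_fun_def lunit_fun_def runit_fun_def braid_fun_def

lemmas structure_fun_extensional =
  compose_extensional coprod_fun_extensional copair_extensional restrict_extensional

definition assoc_inv_fun ::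
  "'a tagged set \<Rightarrow> 'a tagged set \<Rightarrow> 'a tagged set \<Rightarrow> 'a tagged \<Rightarrow> 'a tagged" where
  "assoc_inv_fun N M K =
     copair N (coprod M K) (\<lambda>i. InL (InL i)) (copair M K (\<lambda>j. InL (InR j)) InR)"

lemma structure_funs_PiE [simp]:
  "\<lbrakk>f \<in> N \<rightarrow>\<^sub>E N'; g \<in> M \<rightarrow>\<^sub>E M'\<rbrakk> \<Longrightarrow> coprod_fun N M f g \<in> coprod N M \<rightarrow>\<^sub>E coprod N' M'"
  "assoc_fun N M K \<in> coprod (coprod N M) K \<rightarrow>\<^sub>E coprod N (coprod M K)"
  "assoc_inv_fun N M K \<in> coprod N (coprod M K) \<rightarrow>\<^sub>E coprod (coprod N M) K"
  "lunit_fun N \<in> coprod {} N \<rightarrow>\<^sub>E N"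
  "runit_fun N \<in> coprod N {} \<rightarrow>\<^sub>E N"
  "braid_fun N M \<in> coprod N M \<rightarrow>\<^sub>E coprod M N"
  by (auto simp: structure_funs assoc_inv_fun_def PiE_mem elim!: coprod_cases)

text \<open>
  The coherence laws, as identities between extensional functions. A function out of a coproduct
  is determined by its values on the two summands, so each law is checked on one element per
  summand. Both \<open>FinSet\<close> and \<open>FinSet2\<close> reduce to these identities, because their arrows compose
  and tensor by the same functions. In the proofs, \<open>extensionalityI\<close> leaves the common domain
  open, and it is found by applying \<open>structure_fun_extensional\<close> to both sides.
\<close>

lemma coprod_fun_id: "coprod_fun N M (\<lambda>i\<in>N. i) (\<lambda>j\<in>M. j) = (\<lambda>k\<in>coprod N M. k)"
  by (rule extensionalityI; (rule structure_fun_extensional)?)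
    (auto simp: structure_funs elim!: coprod_cases)

lemma coprod_fun_compose:
  "coprod_fun N M (compose N f' f) (compose M g' g)
     = compose (coprod N M) (coprod_fun N' M' f' g') (coprod_fun N M f g)"
  if "f \<in> N \<rightarrow>\<^sub>E N'" "g \<in> M \<rightarrow>\<^sub>E M'"
  by (rule extensionalityI; (rule structure_fun_extensional)?)
    (auto simp: structure_funs compose_eq that[THEN PiE_mem] elim!: coprod_cases)

lemma assoc_inv_assoc_fun:
  "compose (coprod (coprod N M) K) (assoc_inv_fun N M K) (assoc_fun N M K)
     = (\<lambda>k\<in>coprod (coprod N M) K. k)"
  by (rule extensionalityI; (rule structure_fun_extensional)?)
    (auto simp: structure_funs assoc_inv_fun_def compose_eq elim!: coprod_cases)

lemma assoc_assoc_inv_fun: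
  "compose (coprod N (coprod M K)) (assoc_fun N M K) (assoc_inv_fun N M K)
     = (\<lambda>k\<in>coprod N (coprod M K). k)"
  by (rule extensionalityI; (rule structure_fun_extensional)?)
    (auto simp: structure_funs assoc_inv_fun_def compose_eq elim!: coprod_cases)

lemma assoc_fun_natural:
  "compose (coprod (coprod N M) K) (assoc_fun N' M' K')
       (coprod_fun (coprod N M) K (coprod_fun N M f g) h)
     = compose (coprod (coprod N M) K) (coprod_fun N (coprod M K) f (coprod_fun M K g h))
       (assoc_fun N M K)"
  if "f \<in> N \<rightarrow>\<^sub>E N'" "g \<in> M \<rightarrow>\<^sub>E M'" "h \<in> K \<rightarrow>\<^sub>E K'"
  by (rule extensionalityI; (rule structure_fun_extensional)?)
    (auto simp: structure_funs compose_eq that[THEN PiE_mem] elim!: coprod_cases)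

lemma InR_lunit_fun: "compose (coprod {} N) (\<lambda>i\<in>N. InR i) (lunit_fun N) = (\<lambda>k\<in>coprod {} N. k)"
  by (rule extensionalityI; (rule structure_fun_extensional)?)
    (auto simp: structure_funs compose_eq elim!: coprod_cases)

lemma lunit_fun_InR: "compose N (lunit_fun N) (\<lambda>i\<in>N. InR i) = (\<lambda>k\<in>N. k)"
  by (rule extensionalityI; (rule structure_fun_extensional)?)
    (auto simp: structure_funs compose_eq elim!: coprod_cases)

lemma InL_runit_fun: "compose (coprod N {}) (\<lambda>i\<in>N. InL i) (runit_fun N) = (\<lambda>k\<in>coprod N {}. k)"
  by (rule extensionalityI; (rule structure_fun_extensional)?)
    (auto simp: structure_funs compose_eq elim!: coprod_cases)

lemma runit_fun_InL: "compose N (runit_fun N) (\<lambda>i\<in>N. InL i) = (\<lambda>k\<in>N. k)"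
  by (rule extensionalityI; (rule structure_fun_extensional)?)
    (auto simp: structure_funs compose_eq elim!: coprod_cases)

lemma lunit_fun_natural:
  "compose (coprod {} N) (lunit_fun M) (coprod_fun {} N e f)
     = compose (coprod {} N) f (lunit_fun N)"
  if "f \<in> N \<rightarrow>\<^sub>E M"
  by (rule extensionalityI; (rule structure_fun_extensional)?)
    (auto simp: structure_funs that[THEN PiE_mem] compose_eq elim!: coprod_cases)

lemma runit_fun_natural:
  "compose (coprod N {}) (runit_fun M) (coprod_fun N {} f e)
     = compose (coprod N {}) f (runit_fun N)"
  if "f \<in> N \<rightarrow>\<^sub>E M"
  by (rule extensionalityI; (rule structure_fun_extensional)?)
    (auto simp: structure_funs that[THEN PiE_mem] compose_eq elim!: coprod_cases)

lemma braid_fun_natural: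
  "compose (coprod N M) (braid_fun N' M') (coprod_fun N M f g)
     = compose (coprod N M) (coprod_fun M N g f) (braid_fun N M)"
  if "f \<in> N \<rightarrow>\<^sub>E N'" "g \<in> M \<rightarrow>\<^sub>E M'"
  by (rule extensionalityI; (rule structure_fun_extensional)?)
    (auto simp: structure_funs compose_eq that[THEN PiE_mem] elim!: coprod_cases)

lemma braid_fun_braid_fun:
  "compose (coprod N M) (braid_fun M N) (braid_fun N M) = (\<lambda>k\<in>coprod N M. k)"
  by (rule extensionalityI; (rule structure_fun_extensional)?)
    (auto simp: structure_funs compose_eq elim!: coprod_cases)

lemma triangle_fun:
  "compose (coprod (coprod N {}) M) (coprod_fun N (coprod {} M) (\<lambda>i\<in>N. i) (lunit_fun M))
       (assoc_fun N {} M)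
     = coprod_fun (coprod N {}) M (runit_fun N) (\<lambda>j\<in>M. j)"
  by (rule extensionalityI; (rule structure_fun_extensional)?)
    (auto simp: structure_funs compose_eq elim!: coprod_cases)

lemma pentagon_fun:
  "compose (coprod (coprod (coprod N M) K) L)
       (compose (coprod (coprod N (coprod M K)) L)
         (coprod_fun N (coprod (coprod M K) L) (\<lambda>i\<in>N. i) (assoc_fun M K L))
         (assoc_fun N (coprod M K) L))
       (coprod_fun (coprod (coprod N M) K) L (assoc_fun N M K) (\<lambda>l\<in>L. l))
     = compose (coprod (coprod (coprod N M) K) L)
       (assoc_fun N M (coprod K L)) (assoc_fun (coprod N M) K L)"
  by (rule extensionalityI; (rule structure_fun_extensional)?)
    (auto simp: structure_funs compose_eq elim!: coprod_cases)

lemma hexagon_fun: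
  "compose (coprod (coprod N M) K)
       (compose (coprod N (coprod M K)) (assoc_fun M K N) (braid_fun N (coprod M K)))
       (assoc_fun N M K)
     = compose (coprod (coprod N M) K)
       (compose (coprod (coprod M N) K)
         (coprod_fun M (coprod N K) (\<lambda>j\<in>M. j) (braid_fun N K)) (assoc_fun M N K))
       (coprod_fun (coprod N M) K (braid_fun N M) (\<lambda>k\<in>K. k))"
  by (rule extensionalityI; (rule structure_fun_extensional)?)
    (auto simp: structure_funs compose_eq elim!: coprod_cases)

lemmas coherence_funs = coprod_fun_id coprod_fun_compose assoc_inv_assoc_fun assoc_assoc_inv_fun
  assoc_fun_natural InR_lunit_fun lunit_fun_InR InL_runit_fun runit_fun_InL lunit_fun_natural
  runit_fun_natural braid_fun_natural braid_fun_braid_fun triangle_fun pentagon_fun hexagon_fun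

lemma hom_FinSet [simp]:
  "(N', \<phi>, M') \<in> hom FinSet N M \<longleftrightarrow> N' = N \<and> M' = M \<and> finite N \<and> finite M \<and> \<phi> \<in> N \<rightarrow>\<^sub>E M"
  by (auto simp: hom_def FinSet_def)

lemma hom_FinSetE:
  assumes "f \<in> hom FinSet N M"
  obtains \<phi> where "f = (N, \<phi>, M)" "finite N" "finite M" "\<phi> \<in> N \<rightarrow>\<^sub>E M"
  using assms by (auto simp: hom_def FinSet_def)

lemma is_isoI:
  "f \<in> hom C a b \<Longrightarrow> g \<in> hom C b a \<Longrightarrow> Comp C g f = Ident C a \<Longrightarrow> Comp C f g = Ident C b
   \<Longrightarrow> is_iso C f"
  by (auto simp: is_iso_def hom_def)

lemma FinSet_simps [simp]:
  "Obj FinSet = {N. finite N}" "Ident FinSet N = (N, \<lambda>i\<in>N. i, N)"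
  "Comp FinSet (M', \<psi>, K) (N, \<phi>, M) = (N, compose N \<psi> \<phi>, K)"
  "Tensor FinSet N M = coprod N M"
  "TensorArr FinSet (N, \<phi>, M) (N', \<phi>', M') = (coprod N N', coprod_fun N N' \<phi> \<phi>', coprod M M')"
  "Unit FinSet = {}"
  "Assoc FinSet N M K = (coprod (coprod N M) K, assoc_fun N M K, coprod N (coprod M K))"
  "LUnit FinSet N = (coprod {} N, lunit_fun N, N)"
  "RUnit FinSet N = (coprod N {}, runit_fun N, N)"
  "Braid FinSet N M = (coprod N M, braid_fun N M, coprod M N)"
  by (simp_all add: FinSet_def)

lemma PiE_compose: "f \<in> N \<rightarrow>\<^sub>E M \<Longrightarrow> g \<in> M \<rightarrow>\<^sub>E K \<Longrightarrow> compose N g f \<in> N \<rightarrow>\<^sub>E K"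
  by (auto simp: PiE_iff compose_eq)

lemma compose_identity:
  "f \<in> N \<rightarrow>\<^sub>E M \<Longrightarrow> compose N f (\<lambda>i\<in>N. i) = f"
  "f \<in> N \<rightarrow>\<^sub>E M \<Longrightarrow> compose N (\<lambda>i\<in>M. i) f = f"
  by (rule extensionalityI; auto simp: compose_eq compose_def PiE_iff extensional_def)+

lemma compose_compose:
  "compose N h (compose N g f) = compose N (compose M h g) f" if "f \<in> N \<rightarrow>\<^sub>E M"
  by (rule extensionalityI; (rule structure_fun_extensional)?)
    (auto simp: compose_eq that[THEN PiE_mem])

lemmas category_funs = PiE_compose compose_identity compose_compose

lemma category_FinSet: "category FinSet"
proof
  show "Dom FinSet f \<in> Obj FinSet" if "f \<in> Arr FinSet" for f :: "'a finset_arr"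
    using that by (auto simp: FinSet_def)
  show "Cod FinSet f \<in> Obj FinSet" if "f \<in> Arr FinSet" for f :: "'a finset_arr"
    using that by (auto simp: FinSet_def)
qed (auto simp: category_funs elim!: hom_FinSetE)

lemma symmetric_monoidal_category_FinSet: "symmetric_monoidal_category FinSet"
proof -
  interpret category FinSet by (rule category_FinSet)
  show ?thesis
  proof
    fix N M K :: "'a finset"
    assume *: "N \<in> Obj FinSet" "M \<in> Obj FinSet" "K \<in> Obj FinSet"
    then show "is_iso FinSet (Assoc FinSet N M K)"
      by (intro is_isoI[where
            g = "(coprod N (coprod M K), assoc_inv_fun N M K, coprod (coprod N M) K)"])
        (auto simp: coherence_funs)
  next
    fix N :: "'a finset"
    assume *: "N \<in> Obj FinSet"
    then show "is_iso FinSet (LUnit FinSet N)"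
      by (intro is_isoI[where g = "(N, \<lambda>i\<in>N. InR i, coprod {} N)"]) (auto simp: coherence_funs)
    from * show "is_iso FinSet (RUnit FinSet N)"
      by (intro is_isoI[where g = "(N, \<lambda>i\<in>N. InL i, coprod N {})"]) (auto simp: coherence_funs)
  qed (auto simp: coherence_funs elim!: hom_FinSetE)
qed

section \<open>Labelled finite sets and the forgetful functor\<close>

lemma fst_labelled_coprod [simp]: "fst (labelled_coprod a b) = coprod (fst a) (fst b)"
  and snd_labelled_coprod [simp]:
    "snd (labelled_coprod a b) = copair (fst a) (fst b) (snd a) (snd b)"
  by (cases a; cases b; simp)+

lemma labelled_empty_simps [simp]:
  "fst labelled_empty = {}" "snd labelled_empty = (\<lambda>_. undefined)"
  by (simp_all add: labelled_empty_def)

lemma Obj_FinSet2: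
  "a \<in> Obj FinSet2 \<longleftrightarrow> finite (fst a) \<and> snd a \<in> fst a \<rightarrow>\<^sub>E {1, 2}"
  by (cases a) (simp add: FinSet2_def)

lemma Obj_labelled_coprod [simp]:
  "a \<in> Obj FinSet2 \<Longrightarrow> b \<in> Obj FinSet2 \<Longrightarrow> labelled_coprod a b \<in> Obj FinSet2"
  by (auto simp: Obj_FinSet2 PiE_iff[of "snd _"])

lemma Obj_labelled_empty [simp]: "labelled_empty \<in> Obj FinSet2"
  by (simp add: Obj_FinSet2)

lemma FinSet2_simps [simp]:
  "Ident FinSet2 a = (a, \<lambda>i\<in>fst a. i, a)"
  "Comp FinSet2 (b', \<psi>, c) (a, \<phi>, b) = (a, compose (fst a) \<psi> \<phi>, c)"
  "Tensor FinSet2 a b = labelled_coprod a b"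
  "TensorArr FinSet2 (a, \<phi>, b) (a', \<phi>', b')
     = (labelled_coprod a a', coprod_fun (fst a) (fst a') \<phi> \<phi>', labelled_coprod b b')"
  "Unit FinSet2 = labelled_empty"
  "Assoc FinSet2 a b c = (labelled_coprod (labelled_coprod a b) c,
     assoc_fun (fst a) (fst b) (fst c), labelled_coprod a (labelled_coprod b c))"
  "LUnit FinSet2 a = (labelled_coprod labelled_empty a, lunit_fun (fst a), a)"
  "RUnit FinSet2 a = (labelled_coprod a labelled_empty, runit_fun (fst a), a)"
  "Braid FinSet2 a b = (labelled_coprod a b, braid_fun (fst a) (fst b), labelled_coprod b a)"
  by (simp_all add: FinSet2_def)

lemma label_compose:
  assumes "\<tau> \<in> N \<rightarrow>\<^sub>E L"
  shows "compose N \<sigma> \<phi> = \<tau> \<longleftrightarrow> (\<forall>i\<in>N. \<sigma> (\<phi> i) = \<tau> i)"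
proof
  assume "\<forall>i\<in>N. \<sigma> (\<phi> i) = \<tau> i"
  with assms show "compose N \<sigma> \<phi> = \<tau>"
    by (intro extensionalityI[OF compose_extensional]) (auto simp: compose_eq PiE_iff)
qed (auto simp: compose_eq)

lemma hom_FinSet2 [simp]:
  "(a', \<phi>, b') \<in> hom FinSet2 a b \<longleftrightarrow> a' = a \<and> b' = b \<and> a \<in> Obj FinSet2 \<and> b \<in> Obj FinSet2 \<and>
     \<phi> \<in> fst a \<rightarrow>\<^sub>E fst b \<and> (\<forall>i\<in>fst a. snd b (\<phi> i) = snd a i)"
  by (cases a; cases b) (auto simp: hom_def FinSet2_def label_compose compose_eq)

lemma hom_FinSet2E:
  assumes "f \<in> hom FinSet2 a b"
  obtains \<phi> where "f = (a, \<phi>, b)" "a \<in> Obj FinSet2" "b \<in> Obj FinSet2"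
    "\<phi> \<in> fst a \<rightarrow>\<^sub>E fst b"
    "\<forall>i\<in>fst a. \<phi> i \<in> fst b" "\<forall>i\<in>fst a. snd b (\<phi> i) = snd a i"
proof -
  obtain a' \<phi> b' where f: "f = (a', \<phi>, b')" by (cases f) auto
  show ?thesis using assms that[of \<phi>] unfolding f hom_FinSet2 by (auto dest: PiE_mem)
qed

lemma Arr_hom: "f \<in> Arr C \<Longrightarrow> f \<in> hom C (Dom C f) (Cod C f)"
  by (simp add: hom_def)

lemma category_FinSet2: "category FinSet2"
proof
  show "Dom FinSet2 f \<in> Obj FinSet2" if "f \<in> Arr FinSet2" for f :: "'a labelled_arr"
    using Arr_hom[OF that] by (elim hom_FinSet2E)
  show "Cod FinSet2 f \<in> Obj FinSet2" if "f \<in> Arr FinSet2" for f :: "'a labelled_arr"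
    using Arr_hom[OF that] by (elim hom_FinSet2E)
qed (auto simp: category_funs compose_eq elim!: hom_FinSet2E)

text \<open>
  An arrow of \<open>FinSet2\<close> has to preserve labels. The labelling of a coproduct is a copairing, so
  for the structure maps this says that they carry one copairing to another.
\<close>

lemma coprod_fun_label [simp]:
  assumes "\<forall>i\<in>N. \<sigma> (f i) = \<tau> i" "\<forall>j\<in>M. \<sigma>' (g j) = \<tau>' j"
    and mem: "f \<in> N \<rightarrow>\<^sub>E N'" "g \<in> M \<rightarrow>\<^sub>E M'" and "k \<in> coprod N M"
  shows "copair N' M' \<sigma> \<sigma>' (coprod_fun N M f g k) = copair N M \<tau> \<tau>' k"
  using assms(1,2,5) by (auto simp: structure_funs mem[THEN PiE_mem] elim!: coprod_cases)

lemma structure_funs_label [simp]: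
  "k \<in> coprod (coprod N M) K \<Longrightarrow>
    copair N (coprod M K) f (copair M K g h) (assoc_fun N M K k)
     = copair (coprod N M) K (copair N M f g) h k"
  "k \<in> coprod N (coprod M K) \<Longrightarrow>
    copair (coprod N M) K (copair N M f g) h (assoc_inv_fun N M K k)
     = copair N (coprod M K) f (copair M K g h) k"
  "k \<in> coprod {} N \<Longrightarrow> f (lunit_fun N k) = copair {} N e f k"
  "k \<in> coprod N {} \<Longrightarrow> f (runit_fun N k) = copair N {} f e k"
  "k \<in> coprod N M \<Longrightarrow> copair M N g f (braid_fun N M k) = copair N M f g k"
  by (auto simp: structure_funs assoc_inv_fun_def elim!: coprod_cases)

lemma symmetric_monoidal_category_FinSet2: "symmetric_monoidal_category FinSet2"
proof -
  interpret category FinSet2 by (rule category_FinSet2)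
  show ?thesis
  proof
    fix a b c :: "'a labelled"
    assume "a \<in> Obj FinSet2" "b \<in> Obj FinSet2" "c \<in> Obj FinSet2"
    then show "is_iso FinSet2 (Assoc FinSet2 a b c)"
      by (intro is_isoI[where a = "labelled_coprod (labelled_coprod a b) c"
            and b = "labelled_coprod a (labelled_coprod b c)"
            and g = "(labelled_coprod a (labelled_coprod b c),
            assoc_inv_fun (fst a) (fst b) (fst c), labelled_coprod (labelled_coprod a b) c)"])
        (simp_all add: coherence_funs)
  next
    fix a :: "'a labelled"
    assume *: "a \<in> Obj FinSet2"
    then show "is_iso FinSet2 (LUnit FinSet2 a)"
      by (intro is_isoI[where a = "labelled_coprod labelled_empty a" and b = a
            and g = "(a, \<lambda>i\<in>fst a. InR i, labelled_coprod labelled_empty a)"])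
        (simp_all add: coherence_funs)
    from * show "is_iso FinSet2 (RUnit FinSet2 a)"
      by (intro is_isoI[where a = "labelled_coprod a labelled_empty" and b = a
            and g = "(a, \<lambda>i\<in>fst a. InL i, labelled_coprod a labelled_empty)"])
        (simp_all add: coherence_funs)
  qed ((elim hom_FinSet2E)?, simp add: coherence_funs)+
qed

lemma Forget_simps [simp]:
  "ObjMap Forget a = fst a" "ArrMap Forget (a, \<phi>, b) = (fst a, \<phi>, fst b)"
  by (simp_all add: Forget_def)

lemma strict_symmetric_monoidal_functor_Forget:
  "strict_symmetric_monoidal_functor FinSet2 FinSet Forget"
proof -
  interpret C: symmetric_monoidal_category FinSet2
    by (rule symmetric_monoidal_category_FinSet2)
  interpret D: symmetric_monoidal_category FinSet
    by (rule symmetric_monoidal_category_FinSet)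
  show ?thesis
  proof
    fix f g :: "'a labelled_arr"
    assume "f \<in> Arr FinSet2" "g \<in> Arr FinSet2"
    then show "ArrMap Forget (TensorArr FinSet2 f g)
                 = TensorArr FinSet (ArrMap Forget f) (ArrMap Forget g)"
      by (cases f; cases g) simp
  qed (auto simp: Obj_FinSet2 elim!: hom_FinSet2E)
qed

section \<open>Functors to commutative monoids are lax monoidal\<close>

text \<open>
  The part of the coproduct structure that the lax monoidal laws use: natural inclusions into the
  tensor product, compatible with the associators, unitors and braiding.
\<close>

locale category_with_inclusions = symmetric_monoidal_category C
  for C :: "('o, 'm, 'z) smcat_scheme" (structure) +
  fixes inl inr :: "'o \<Rightarrow> 'o \<Rightarrow> 'm"
  assumes inl_hom: "\<lbrakk>a \<in> Obj C; b \<in> Obj C\<rbrakk> \<Longrightarrow> inl a b \<in> hom C a (a \<oplus> b)"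
    and inr_hom: "\<lbrakk>a \<in> Obj C; b \<in> Obj C\<rbrakk> \<Longrightarrow> inr a b \<in> hom C b (a \<oplus> b)"
    and tensor_inl: "\<lbrakk>f \<in> hom C a a'; g \<in> hom C b b'\<rbrakk>
          \<Longrightarrow> TensorArr C f g \<odot> inl a b = inl a' b' \<odot> f"
    and tensor_inr: "\<lbrakk>f \<in> hom C a a'; g \<in> hom C b b'\<rbrakk>
          \<Longrightarrow> TensorArr C f g \<odot> inr a b = inr a' b' \<odot> g"
    and assoc_inl_inl: "\<lbrakk>a \<in> Obj C; b \<in> Obj C; c \<in> Obj C\<rbrakk>
          \<Longrightarrow> Assoc C a b c \<odot> (inl (a \<oplus> b) c \<odot> inl a b) = inl a (b \<oplus> c)"
    and assoc_inl_inr: "\<lbrakk>a \<in> Obj C; b \<in> Obj C; c \<in> Obj C\<rbrakk>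
          \<Longrightarrow> Assoc C a b c \<odot> (inl (a \<oplus> b) c \<odot> inr a b) = inr a (b \<oplus> c) \<odot> inl b c"
    and assoc_inr: "\<lbrakk>a \<in> Obj C; b \<in> Obj C; c \<in> Obj C\<rbrakk>
          \<Longrightarrow> Assoc C a b c \<odot> inr (a \<oplus> b) c = inr a (b \<oplus> c) \<odot> inr b c"
    and lunit_inr: "a \<in> Obj C \<Longrightarrow> LUnit C a \<odot> inr (Unit C) a = Ident C a"
    and runit_inl: "a \<in> Obj C \<Longrightarrow> RUnit C a \<odot> inl a (Unit C) = Ident C a"
    and braid_inl: "\<lbrakk>a \<in> Obj C; b \<in> Obj C\<rbrakk> \<Longrightarrow> Braid C a b \<odot> inl a b = inr b a"
    and braid_inr: "\<lbrakk>a \<in> Obj C; b \<in> Obj C\<rbrakk> \<Longrightarrow> Braid C a b \<odot> inr a b = inl b a"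

text \<open>
  The operations \<open>add\<close> and \<open>zero\<close> live on the value sets rather than on a type class, because
  the values at different objects are different sets of elements of one type. The last two
  assumptions say that the comparisons are the canonical ones: map both arguments into the
  value at \<open>a \<oplus> b\<close> along the inclusions and add them there, and pick zero over the unit.
\<close>

locale commutative_monoid_valued_functor = category_with_inclusions C inl inr
  for C :: "('o, 'm, 'z) smcat_scheme" (structure) and inl inr +
  fixes F :: "('o, 'm, 'x) set_functor"
    and add :: "'o \<Rightarrow> 'x \<Rightarrow> 'x \<Rightarrow> 'x" and zero :: "'o \<Rightarrow> 'x"
  assumes act_mem: "\<lbrakk>f \<in> hom C a b; x \<in> SetObj F a\<rbrakk> \<Longrightarrow> SetArr F f x \<in> SetObj F b"
    and act_ident: "\<lbrakk>a \<in> Obj C; x \<in> SetObj F a\<rbrakk> \<Longrightarrow> SetArr F (Ident C a) x = x"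
    and act_comp: "\<lbrakk>f \<in> hom C a b; g \<in> hom C b c; x \<in> SetObj F a\<rbrakk>
          \<Longrightarrow> SetArr F (g \<odot> f) x = SetArr F g (SetArr F f x)"
    and add_mem: "\<lbrakk>a \<in> Obj C; x \<in> SetObj F a; y \<in> SetObj F a\<rbrakk> \<Longrightarrow> add a x y \<in> SetObj F a"
    and zero_mem: "a \<in> Obj C \<Longrightarrow> zero a \<in> SetObj F a"
    and add_assoc: "\<lbrakk>a \<in> Obj C; x \<in> SetObj F a; y \<in> SetObj F a; z \<in> SetObj F a\<rbrakk>
          \<Longrightarrow> add a (add a x y) z = add a x (add a y z)"
    and add_commute: "\<lbrakk>a \<in> Obj C; x \<in> SetObj F a; y \<in> SetObj F a\<rbrakk> \<Longrightarrow> add a x y = add a y x"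
    and zero_add: "\<lbrakk>a \<in> Obj C; x \<in> SetObj F a\<rbrakk> \<Longrightarrow> add a (zero a) x = x"
    and act_add: "\<lbrakk>f \<in> hom C a b; x \<in> SetObj F a; y \<in> SetObj F a\<rbrakk>
          \<Longrightarrow> SetArr F f (add a x y) = add b (SetArr F f x) (SetArr F f y)"
    and act_zero: "f \<in> hom C a b \<Longrightarrow> SetArr F f (zero a) = zero b"
    and prod_comparison: "\<lbrakk>a \<in> Obj C; b \<in> Obj C; x \<in> SetObj F a; y \<in> SetObj F b\<rbrakk>
          \<Longrightarrow> ProdComparison F a b (x, y)
             = add (a \<oplus> b) (SetArr F (inl a b) x) (SetArr F (inr a b) y)"
    and unit_comparison: "UnitComparison F () = zero (Unit C)"
begin

lemma hom_obj:
  assumes "f \<in> hom C a b" shows "a \<in> Obj C" "b \<in> Obj C"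
  using assms dom_obj cod_obj by (auto simp: hom_def)

text \<open>
  The action of \<open>f\<close> on a product comparison depends only on the two composites of \<open>f\<close> with the
  inclusions. All coherence laws for the comparisons reduce to this.
\<close>

lemma act_prod_comparison:
  assumes "f \<in> hom C (a \<oplus> b) c" "a \<in> Obj C" "b \<in> Obj C" "x \<in> SetObj F a" "y \<in> SetObj F b"
  shows "SetArr F f (ProdComparison F a b (x, y))
           = add c (SetArr F (f \<odot> inl a b) x) (SetArr F (f \<odot> inr a b) y)"
  using assms inl_hom[of a b] inr_hom[of a b]
  by (simp add: prod_comparison act_add[OF assms(1)] act_mem[OF inl_hom] act_mem[OF inr_hom]
      act_comp[OF inl_hom assms(1)] act_comp[OF inr_hom assms(1)])

sublocale lax_symmetric_monoidal_functor C F
proof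
  fix f a b assume "f \<in> hom C a b"
  then show "SetArr F f \<in> SetObj F a \<rightarrow> SetObj F b" by (auto intro: act_mem)
next
  fix a x assume "a \<in> Obj C" "x \<in> SetObj F a"
  then show "SetArr F (Ident C a) x = x" by (rule act_ident)
next
  fix f a b g c x assume "f \<in> hom C a b" "g \<in> hom C b c" "x \<in> SetObj F a"
  then show "SetArr F (g \<odot> f) x = SetArr F g (SetArr F f x)" by (rule act_comp)
next
  fix a b assume ab: "a \<in> Obj C" "b \<in> Obj C"
  show "ProdComparison F a b \<in> SetObj F a \<times> SetObj F b \<rightarrow> SetObj F (a \<oplus> b)"
  proof (rule funcsetI, clarify)
    fix x y assume "x \<in> SetObj F a" "y \<in> SetObj F b"
    with ab show "ProdComparison F a b (x, y) \<in> SetObj F (a \<oplus> b)"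
      by (simp add: prod_comparison add_mem tensor_obj act_mem[OF inl_hom] act_mem[OF inr_hom])
  qed
next
  show "UnitComparison F \<in> {()} \<rightarrow> SetObj F (Unit C)"
    by (simp add: unit_comparison zero_mem unit_obj)
next
  fix f a a' g b b' x y
  assume f: "f \<in> hom C a a'" and g: "g \<in> hom C b b'"
    and xy: "x \<in> SetObj F a" "y \<in> SetObj F b"
  note objs = hom_obj[OF f] hom_obj[OF g]
  have "SetArr F (TensorArr C f g) (ProdComparison F a b (x, y))
      = add (a' \<oplus> b') (SetArr F (inl a' b' \<odot> f) x) (SetArr F (inr a' b' \<odot> g) y)"
    using act_prod_comparison[OF tensor_hom[OF f g]] objs xy
    by (simp add: tensor_inl[OF f g] tensor_inr[OF f g])
  also have "\<dots> = ProdComparison F a' b' (SetArr F f x, SetArr F g y)"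
    using objs xy
    by (simp add: prod_comparison act_mem[OF f] act_mem[OF g] act_comp[OF f inl_hom]
        act_comp[OF g inr_hom])
  finally show "SetArr F (TensorArr C f g) (ProdComparison F a b (x, y))
      = ProdComparison F a' b' (SetArr F f x, SetArr F g y)" .
next
  fix a b c x y z
  assume abc: "a \<in> Obj C" "b \<in> Obj C" "c \<in> Obj C"
    and xyz: "x \<in> SetObj F a" "y \<in> SetObj F b" "z \<in> SetObj F c"
  let ?l = "inl (a \<oplus> b) c"
  let ?\<alpha> = "Assoc C a b c"
  let ?T = "a \<oplus> (b \<oplus> c)"
  note homs = inl_hom inr_hom assoc_hom tensor_obj abc
  note mem = act_mem[OF inl_hom] act_mem[OF inr_hom]
  have \<alpha>l: "?\<alpha> \<odot> ?l \<in> hom C (a \<oplus> b) ?T"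
    using comp_hom[of ?l "a \<oplus> b" "(a \<oplus> b) \<oplus> c" ?\<alpha> ?T] by (simp add: homs)
  have ll: "(?\<alpha> \<odot> ?l) \<odot> inl a b = inl a (b \<oplus> c)"
    using comp_assoc[of "inl a b" a "a \<oplus> b" ?l "(a \<oplus> b) \<oplus> c" ?\<alpha> ?T]
    by (simp add: homs assoc_inl_inl)
  have lr: "(?\<alpha> \<odot> ?l) \<odot> inr a b = inr a (b \<oplus> c) \<odot> inl b c"
    using comp_assoc[of "inr a b" b "a \<oplus> b" ?l "(a \<oplus> b) \<oplus> c" ?\<alpha> ?T]
    by (simp add: homs assoc_inl_inr)
  have P: "ProdComparison F a b (x, y) \<in> SetObj F (a \<oplus> b)"
    using abc xyz by (simp add: prod_comparison add_mem tensor_obj mem)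
  have "SetArr F ?\<alpha> (ProdComparison F (a \<oplus> b) c (ProdComparison F a b (x, y), z))
      = add ?T (SetArr F (?\<alpha> \<odot> ?l) (ProdComparison F a b (x, y)))
               (SetArr F (?\<alpha> \<odot> inr (a \<oplus> b) c) z)"
    using P abc xyz by (simp add: act_prod_comparison[OF assoc_hom] tensor_obj)
  also have "\<dots> = add ?T (add ?T (SetArr F (inl a (b \<oplus> c)) x)
                             (SetArr F (inr a (b \<oplus> c) \<odot> inl b c) y))
                      (SetArr F (inr a (b \<oplus> c) \<odot> inr b c) z)"
    using abc xyz by (simp add: act_prod_comparison[OF \<alpha>l] ll lr assoc_inr)
  also have "\<dots> = add ?T (SetArr F (inl a (b \<oplus> c)) x)
                    (add ?T (SetArr F (inr a (b \<oplus> c) \<odot> inl b c) y)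
                            (SetArr F (inr a (b \<oplus> c) \<odot> inr b c) z))"
    using abc xyz
    by (intro add_assoc) (simp_all add: tensor_obj mem act_comp[OF inl_hom inr_hom]
        act_comp[OF inr_hom inr_hom])
  also have "\<dots> = ProdComparison F a (b \<oplus> c) (x, ProdComparison F b c (y, z))"
    using abc xyz
    by (simp add: prod_comparison tensor_obj mem add_mem act_add[OF inr_hom]
        act_comp[OF inl_hom inr_hom] act_comp[OF inr_hom inr_hom])
  finally show "SetArr F ?\<alpha> (ProdComparison F (a \<oplus> b) c (ProdComparison F a b (x, y), z))
      = ProdComparison F a (b \<oplus> c) (x, ProdComparison F b c (y, z))" .
next
  fix a x assume a: "a \<in> Obj C" and x: "x \<in> SetObj F a"
  have "LUnit C a \<odot> inl (Unit C) a \<in> hom C (Unit C) a"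
    using comp_hom[OF inl_hom lunit_hom] a unit_obj by simp
  with a x show "SetArr F (LUnit C a) (ProdComparison F (Unit C) a (UnitComparison F (), x)) = x"
    by (simp add: unit_comparison act_prod_comparison[OF lunit_hom] unit_obj zero_mem lunit_inr
        act_ident act_zero zero_add)
  have "RUnit C a \<odot> inr a (Unit C) \<in> hom C (Unit C) a"
    using comp_hom[OF inr_hom runit_hom] a unit_obj by simp
  with a x show "SetArr F (RUnit C a) (ProdComparison F a (Unit C) (x, UnitComparison F ())) = x"
    by (simp add: unit_comparison act_prod_comparison[OF runit_hom] unit_obj zero_mem runit_inl
        act_ident act_zero add_commute[of a x] zero_add)
next
  fix a b x y
  assume ab: "a \<in> Obj C" "b \<in> Obj C" and xy: "x \<in> SetObj F a" "y \<in> SetObj F b"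
  have "SetArr F (Braid C a b) (ProdComparison F a b (x, y))
      = add (b \<oplus> a) (SetArr F (inr b a) x) (SetArr F (inl b a) y)"
    using act_prod_comparison[OF braid_hom] ab xy by (simp add: braid_inl braid_inr)
  also have "\<dots> = ProdComparison F b a (y, x)"
    using ab xy
    by (simp add: prod_comparison act_mem[OF inl_hom] act_mem[OF inr_hom]
        add_commute[OF tensor_obj, of b a "SetArr F (inr b a) x"])
  finally show "SetArr F (Braid C a b) (ProdComparison F a b (x, y)) = ProdComparison F b a (y, x)" .
qed

end

text \<open>
  A strict functor that preserves the inclusions preserves the canonical comparisons, so the
  composite is again of the same kind. This covers \<open>DynamD\<close> on labelled finite sets.
\<close>

lemma commutative_monoid_valued_functor_precompose:
  assumes "strict_symmetric_monoidal_functor C D U"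
    and "category_with_inclusions C inl inr"
    and "commutative_monoid_valued_functor D inl' inr' F add zero"
    and inl: "\<And>a b. ArrMap U (inl a b) = inl' (ObjMap U a) (ObjMap U b)"
    and inr: "\<And>a b. ArrMap U (inr a b) = inr' (ObjMap U a) (ObjMap U b)"
  shows "commutative_monoid_valued_functor C inl inr (precompose F U)
           (\<lambda>a. add (ObjMap U a)) (\<lambda>a. zero (ObjMap U a))"
proof -
  interpret U: strict_symmetric_monoidal_functor C D U by fact
  interpret C: category_with_inclusions C inl inr by fact
  interpret F: commutative_monoid_valued_functor D inl' inr' F add zero by fact
  show ?thesis
  \<comment> \<open>The cases follow the order of the assumptions of \<open>commutative_monoid_valued_functor\<close>.\<close>
  proof (unfold_locales, goal_cases)
    case (3 f a b g x)
    then show ?case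
      by (simp add: precompose_def U.map_comp[OF 3(1,2)] F.act_comp[OF 3(1,2)[THEN U.map_hom]])
  next
    case 7
    then show ?case by (simp add: precompose_def U.map_obj F.add_commute)
  qed (simp_all add: precompose_def U.map_obj U.map_ident U.map_tensor U.map_unit inl inr
      F.act_mem[OF U.map_hom] F.act_ident F.add_mem F.zero_mem F.add_assoc
      F.zero_add F.act_add[OF U.map_hom] F.act_zero[OF U.map_hom] F.prod_comparison
      F.unit_comparison)
qed

text \<open>
  Compatibility with the product comparisons is automatic: \<open>\<alpha>\<close> commutes with the
  action of the inclusions by naturality, and with the addition because its components are
  homomorphisms.
\<close>

lemma monoidal_natural_transformationI:
  assumes "commutative_monoid_valued_functor C inl inr F addF zeroF"
    and "commutative_monoid_valued_functor C inl inr G addG zeroG"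
    and mem: "\<And>a x. \<lbrakk>a \<in> Obj C; x \<in> SetObj F a\<rbrakk> \<Longrightarrow> \<alpha> a x \<in> SetObj G a"
    and natural: "\<And>f a b x. \<lbrakk>f \<in> hom C a b; x \<in> SetObj F a\<rbrakk>
          \<Longrightarrow> \<alpha> b (SetArr F f x) = SetArr G f (\<alpha> a x)"
    and add: "\<And>a x y. \<lbrakk>a \<in> Obj C; x \<in> SetObj F a; y \<in> SetObj F a\<rbrakk>
          \<Longrightarrow> \<alpha> a (addF a x y) = addG a (\<alpha> a x) (\<alpha> a y)"
    and zero: "\<alpha> (Unit C) (zeroF (Unit C)) = zeroG (Unit C)"
  shows "monoidal_natural_transformation C F G \<alpha>"
proof -
  interpret F: commutative_monoid_valued_functor C inl inr F addF zeroF by fact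
  interpret G: commutative_monoid_valued_functor C inl inr G addG zeroG by fact
  show ?thesis
  proof
    fix a b x y
    assume ab: "a \<in> Obj C" "b \<in> Obj C" and xy: "x \<in> SetObj F a" "y \<in> SetObj F b"
    then show "\<alpha> (a \<oplus>\<^bsub>C\<^esub> b) (ProdComparison F a b (x, y)) = ProdComparison G a b (\<alpha> a x, \<alpha> b y)"
      by (simp add: F.prod_comparison G.prod_comparison mem add F.tensor_obj
          F.act_mem[OF F.inl_hom] F.act_mem[OF F.inr_hom]
          natural[OF F.inl_hom] natural[OF F.inr_hom])
  qed (auto simp: mem natural zero F.unit_comparison G.unit_comparison)
qed

section \<open>The coproduct inclusions of finite sets\<close>

definition FinSet_inl :: "'a finset \<Rightarrow> 'a finset \<Rightarrow> 'a finset_arr" where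
  "FinSet_inl N M = (N, \<lambda>i\<in>N. InL i, coprod N M)"

definition FinSet_inr :: "'a finset \<Rightarrow> 'a finset \<Rightarrow> 'a finset_arr" where
  "FinSet_inr N M = (M, \<lambda>j\<in>M. InR j, coprod N M)"

definition FinSet2_inl :: "'a labelled \<Rightarrow> 'a labelled \<Rightarrow> 'a labelled_arr" where
  "FinSet2_inl a b = (a, \<lambda>i\<in>fst a. InL i, labelled_coprod a b)"

definition FinSet2_inr :: "'a labelled \<Rightarrow> 'a labelled \<Rightarrow> 'a labelled_arr" where
  "FinSet2_inr a b = (b, \<lambda>j\<in>fst b. InR j, labelled_coprod a b)"

lemma coprod_fun_InL:
  "compose N (coprod_fun N M f g) (\<lambda>i\<in>N. InL i) = compose N (\<lambda>i\<in>N'. InL i) f"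
  if "f \<in> N \<rightarrow>\<^sub>E N'"
  by (rule extensionalityI; (rule structure_fun_extensional)?)
    (auto simp: structure_funs compose_eq that[THEN PiE_mem])

lemma coprod_fun_InR:
  "compose M (coprod_fun N M f g) (\<lambda>j\<in>M. InR j) = compose M (\<lambda>j\<in>M'. InR j) g"
  if "g \<in> M \<rightarrow>\<^sub>E M'"
  by (rule extensionalityI; (rule structure_fun_extensional)?)
    (auto simp: structure_funs compose_eq that[THEN PiE_mem])

lemma assoc_fun_InL_InL:
  "compose N (assoc_fun N M K) (compose N (\<lambda>k\<in>coprod N M. InL k) (\<lambda>i\<in>N. InL i)) = (\<lambda>i\<in>N. InL i)"
  by (rule extensionalityI; (rule structure_fun_extensional)?)
    (auto simp: structure_funs compose_eq)

lemma assoc_fun_InL_InR: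
  "compose M (assoc_fun N M K) (compose M (\<lambda>k\<in>coprod N M. InL k) (\<lambda>j\<in>M. InR j))
     = compose M (\<lambda>k\<in>coprod M K. InR k) (\<lambda>j\<in>M. InL j)"
  by (rule extensionalityI; (rule structure_fun_extensional)?)
    (auto simp: structure_funs compose_eq)

lemma assoc_fun_InR:
  "compose K (assoc_fun N M K) (\<lambda>k\<in>K. InR k)
     = compose K (\<lambda>k\<in>coprod M K. InR k) (\<lambda>k\<in>K. InR k)"
  by (rule extensionalityI; (rule structure_fun_extensional)?)
    (auto simp: structure_funs compose_eq)

lemma braid_fun_InL: "compose N (braid_fun N M) (\<lambda>i\<in>N. InL i) = (\<lambda>i\<in>N. InR i)"
  by (rule extensionalityI; (rule structure_fun_extensional)?)
    (auto simp: structure_funs compose_eq)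

lemma braid_fun_InR: "compose M (braid_fun N M) (\<lambda>j\<in>M. InR j) = (\<lambda>j\<in>M. InL j)"
  by (rule extensionalityI; (rule structure_fun_extensional)?)
    (auto simp: structure_funs compose_eq)

lemmas inclusion_funs = coprod_fun_InL coprod_fun_InR assoc_fun_InL_InL assoc_fun_InL_InR
  assoc_fun_InR lunit_fun_InR runit_fun_InL braid_fun_InL braid_fun_InR

lemma category_with_inclusions_FinSet: "category_with_inclusions FinSet FinSet_inl FinSet_inr"
proof -
  interpret symmetric_monoidal_category FinSet by (rule symmetric_monoidal_category_FinSet)
  show ?thesis
    by unfold_locales
      ((elim hom_FinSetE)?, simp add: FinSet_inl_def FinSet_inr_def inclusion_funs)+
qed

lemma category_with_inclusions_FinSet2:
  "category_with_inclusions FinSet2 FinSet2_inl FinSet2_inr"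
proof -
  interpret symmetric_monoidal_category FinSet2 by (rule symmetric_monoidal_category_FinSet2)
  show ?thesis
    by unfold_locales
      ((elim hom_FinSet2E)?, simp add: FinSet2_inl_def FinSet2_inr_def inclusion_funs)+
qed

lemma Forget_inclusions:
  "ArrMap Forget (FinSet2_inl a b) = FinSet_inl (ObjMap Forget a) (ObjMap Forget b)"
  "ArrMap Forget (FinSet2_inr a b) = FinSet_inr (ObjMap Forget a) (ObjMap Forget b)"
  by (simp_all add: FinSet2_inl_def FinSet2_inr_def FinSet_inl_def FinSet_inr_def)

section \<open>Continuously differentiable functions and the chain rule\<close>

lemma Rvec_upd: "x \<in> Rvec N \<Longrightarrow> i \<in> N \<Longrightarrow> x(i := t) \<in> Rvec N"
  by (auto simp: Rvec_def PiE_iff extensional_def)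

lemma pull_Rvec [simp]: "pull N \<phi> y \<in> Rvec N"
  by (simp add: pull_def Rvec_def)

lemma C1_partial:
  assumes "C1 N f" "x \<in> Rvec N" "i \<in> N"
  shows "((\<lambda>t. f (x(i := t))) has_field_derivative grad N f x i) (at (x i))"
  using assms by (simp add: C1_def has_partials_def grad_def DERIV_deriv_iff_real_differentiable)

lemma grad_eqI:
  assumes "((\<lambda>t. f (x(i := t))) has_field_derivative d) (at (x i))" "i \<in> N"
  shows "grad N f x i = d"
  using assms by (simp add: grad_def DERIV_imp_deriv)

text \<open>
  The partial derivatives are given by a formula \<open>G\<close>, which spares reasoning about \<open>deriv\<close>.
\<close>

lemma C1I:
  assumes d: "\<And>x i. \<lbrakk>x \<in> Rvec N; i \<in> N\<rbrakk>
      \<Longrightarrow> ((\<lambda>t. f (x(i := t))) has_field_derivative G x i) (at (x i))"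
    and c: "\<And>i. i \<in> N
      \<Longrightarrow> continuous_map (product_topology (\<lambda>_. euclideanreal) N) euclideanreal (\<lambda>x. G x i)"
  shows "C1 N f"
  unfolding C1_def has_partials_def
proof safe
  show "(\<lambda>t. f (x(i := t))) differentiable at (x i)" if "x \<in> Rvec N" "i \<in> N" for x i
    using d[OF that] real_differentiable_def by blast
  show "continuous_map (product_topology (\<lambda>_. euclideanreal) N) euclideanreal
      (\<lambda>x. grad N f x i)" if "i \<in> N" for i
    by (rule continuous_map_eq[OF c[OF that]]) (simp add: grad_eqI[OF d] that flip: Rvec_def)
qed

lemma C1_grad_continuous:
  "C1 N f \<Longrightarrow> i \<in> N
    \<Longrightarrow> continuous_map (product_topology (\<lambda>_. euclideanreal) N) euclideanreal (\<lambda>x. grad N f x i)"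
  by (simp add: C1_def)

lemma C1_restrict:
  assumes "C1 N f" shows "C1 N (restrict f (Rvec N))"
proof (rule C1I)
  fix x i assume "x \<in> Rvec N" "i \<in> N"
  then show "((\<lambda>t. restrict f (Rvec N) (x(i := t))) has_field_derivative grad N f x i) (at (x i))"
    using C1_partial[OF assms] by (simp add: Rvec_upd)
qed (rule C1_grad_continuous[OF assms])

lemma grad_restrict: "x \<in> Rvec N \<Longrightarrow> grad N (restrict f (Rvec N)) x = grad N f x"
  unfolding grad_def by (intro restrict_ext) (simp add: Rvec_upd)

lemma C1_add:
  assumes f: "C1 N f" and g: "C1 N g"
  shows "C1 N (\<lambda>x. f x + g x)"
    and "\<lbrakk>x \<in> Rvec N; i \<in> N\<rbrakk> \<Longrightarrow> grad N (\<lambda>x. f x + g x) x i = grad N f x i + grad N g x i"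
proof -
  note d = DERIV_add[OF C1_partial[OF f] C1_partial[OF g]]
  show "C1 N (\<lambda>x. f x + g x)"
    by (rule C1I[OF d])
      (auto intro!: continuous_map_add C1_grad_continuous f g)
  show "\<lbrakk>x \<in> Rvec N; i \<in> N\<rbrakk> \<Longrightarrow> grad N (\<lambda>x. f x + g x) x i = grad N f x i + grad N g x i"
    by (rule grad_eqI[OF d])
qed

lemma C1_const: "C1 N (\<lambda>_. c)"
  by (rule C1I[where G = "\<lambda>_ _. 0"]) auto

lemma grad_const: "i \<in> N \<Longrightarrow> grad N (\<lambda>_. c) x i = 0"
  by (simp add: grad_def)

lemma override_on_Rvec: "\<lbrakk>x \<in> Rvec N; S \<subseteq> N\<rbrakk> \<Longrightarrow> override_on x (\<lambda>_. t) S \<in> Rvec N"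
  by (auto simp: Rvec_def PiE_iff extensional_def override_on_def)

text \<open>
  Induction on \<open>S\<close>: a function of two real variables, one for the coordinates in \<open>S\<close> and one for
  the new coordinate \<open>k\<close>, is totally differentiable if it is differentiable in the first variable
  and has a continuous partial derivative in the second. Its restriction to the diagonal then has
  the sum of the partial derivatives as its derivative.
\<close>

lemma C1_diagonal_derivative:
  assumes f: "C1 N f" and "finite S" "S \<subseteq> N" "x \<in> Rvec N"
  shows "((\<lambda>t. f (override_on x (\<lambda>_. t) S)) has_field_derivative
            (\<Sum>i\<in>S. grad N f (override_on x (\<lambda>_. c) S) i)) (at c)"
  using assms(2-)
proof (induction S arbitrary: x rule: finite_induct)
  case empty
  then show ?case by simp
next
  case (insert k S)
  \<comment> \<open>The point with \<open>s\<close> at the coordinates in \<open>S\<close> and \<open>u\<close> at the coordinate \<open>k\<close>.\<close>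
  define p where "p = (\<lambda>s u. (override_on x (\<lambda>_. s) S)(k := u))"
  have p_Rvec: "p s u \<in> Rvec N" for s u
    using insert.prems by (simp add: p_def Rvec_upd override_on_Rvec)
  \<comment> \<open>For fixed \<open>u\<close> the induction hypothesis applies at the base point \<open>x(k := u)\<close>.\<close>
  have p_IH: "p s u = override_on (x(k := u)) (\<lambda>_. s) S" for s u
    using insert.hyps by (auto simp: p_def override_on_def)
  have p_diag: "p t t = override_on x (\<lambda>_. t) (insert k S)" for t
    by (simp add: p_def override_on_insert)
  let ?A = "\<Sum>i\<in>S. grad N f (p c c) i"
  let ?g = "\<lambda>s u. grad N f (p s u) k"
  have "((\<lambda>s. f (p s c)) has_field_derivative ?A) (at c)"
    unfolding p_IH using insert.prems by (intro insert.IH Rvec_upd) auto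
  then have first: "((\<lambda>s. f (p s c)) has_derivative (*) ?A) (at c within UNIV)"
    by (simp add: has_field_derivative_def)
  have second: "((\<lambda>u. f (p s u)) has_derivative blinfun_apply (blinfun_mult_right (?g s u)))
      (at u within UNIV)" for s u
  proof -
    have "p s u k = u" "(p s u)(k := t) = p s t" for t by (simp_all add: p_def)
    then show ?thesis
      using C1_partial[OF f p_Rvec, of k s u] insert.prems
      by (simp add: has_field_derivative_def)
  qed
  have "continuous_map euclidean (product_topology (\<lambda>_. euclideanreal) N) (\<lambda>(s, u). p s u)"
  proof (unfold continuous_map_componentwise, intro conjI ballI)
    show "(\<lambda>(s, u). p s u) ` topspace euclidean \<subseteq> extensional N"
      using p_Rvec by (auto simp: Rvec_def PiE_iff)
    fix i assume "i \<in> N"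
    consider "i = k" | "i \<noteq> k" "i \<in> S" | "i \<noteq> k" "i \<notin> S" by blast
    then show "continuous_map euclidean euclideanreal (\<lambda>z. (case z of (s, u) \<Rightarrow> p s u) i)"
      by cases (simp_all add: p_def case_prod_unfold continuous_on_fst continuous_on_snd
          continuous_on_id)
  qed
  from continuous_map_compose[OF this C1_grad_continuous[OF f, of k]]
  have "continuous_on UNIV (\<lambda>(s, u). ?g s u)"
    using insert.prems by (simp add: o_def case_prod_unfold)
  then have cont: "continuous (at (c, c) within UNIV \<times> UNIV)
      (\<lambda>(s, u). blinfun_mult_right (?g s u))"
    by (auto simp: case_prod_unfold continuous_on_eq_continuous_at
        intro!: bounded_linear.continuous[OF bounded_linear_blinfun_mult_right])
  have "((\<lambda>(s, u). f (p s u)) has_derivative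
      (\<lambda>(ds, du). ?A * ds + blinfun_mult_right (?g c c) du)) (at (c, c) within UNIV \<times> UNIV)"
    by (rule has_derivative_partialsI[OF first second cont]) auto
  then have total: "((\<lambda>(s, u). f (p s u)) has_derivative
      (\<lambda>(ds, du). ?A * ds + ?g c c * du)) (at (c, c))"
    by simp
  have "((\<lambda>t. (t, t)) has_derivative (\<lambda>d. (d, d))) (at c)"
    by (auto intro!: derivative_eq_intros)
  from has_derivative_compose[OF this total]
  have "((\<lambda>t. f (p t t)) has_derivative (\<lambda>d. (?A + ?g c c) * d)) (at c)"
    by (simp add: algebra_simps)
  then show ?case
    using insert.hyps by (simp add: has_field_derivative_def p_diag add.commute)
qed

lemma pull_upd: "pull N \<phi> (y(j := t)) = override_on (pull N \<phi> y) (\<lambda>_. t) {i \<in> N. \<phi> i = j}"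
  by (auto simp: pull_def override_on_def)

text \<open>
  The chain rule for \<open>\<phi>\<^sup>*\<close>. Varying one coordinate \<open>j\<close> of \<open>y\<close> varies \<open>\<phi>\<^sup>* y\<close> along the diagonal
  of the fibre over \<open>j\<close>.
\<close>

lemma C1_pull:
  assumes f: "C1 N f" and N: "finite N" and \<phi>: "\<phi> \<in> N \<rightarrow> M"
  shows "C1 M (\<lambda>y. f (pull N \<phi> y))"
    and "\<lbrakk>y \<in> Rvec M; j \<in> M\<rbrakk>
      \<Longrightarrow> grad M (\<lambda>y. f (pull N \<phi> y)) y j = (\<Sum>i\<in>{i \<in> N. \<phi> i = j}. grad N f (pull N \<phi> y) i)"
proof -
  have d: "((\<lambda>t. f (pull N \<phi> (y(j := t)))) has_field_derivative
      (\<Sum>i\<in>{i \<in> N. \<phi> i = j}. grad N f (pull N \<phi> y) i)) (at (y j))" for y j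
  proof -
    have "override_on (pull N \<phi> y) (\<lambda>_. y j) {i \<in> N. \<phi> i = j} = pull N \<phi> y"
      using pull_upd[of N \<phi> y j "y j"] by simp
    then show ?thesis
      using C1_diagonal_derivative[OF f, of "{i \<in> N. \<phi> i = j}" "pull N \<phi> y" "y j"] N
      by (simp add: pull_upd)
  qed
  have "continuous_map (product_topology (\<lambda>_. euclideanreal) M)
      (product_topology (\<lambda>_. euclideanreal) N) (pull N \<phi>)"
    unfolding continuous_map_componentwise
  proof (intro conjI ballI)
    show "pull N \<phi> ` topspace (product_topology (\<lambda>_. euclideanreal) M) \<subseteq> extensional N"
      by (auto simp: pull_def)
    show "continuous_map (product_topology (\<lambda>_. euclideanreal) M) euclideanreal (\<lambda>y. pull N \<phi> y i)"
      if "i \<in> N" for i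
      using that \<phi> continuous_map_product_projection[of "\<phi> i" M "\<lambda>_. euclideanreal"]
      by (auto simp: pull_def)
  qed
  note c = continuous_map_compose[OF this C1_grad_continuous[OF f], unfolded o_def]
  show "C1 M (\<lambda>y. f (pull N \<phi> y))"
    by (rule C1I[OF d]) (use N in \<open>auto intro!: continuous_map_sum c\<close>)
  show "\<lbrakk>y \<in> Rvec M; j \<in> M\<rbrakk>
      \<Longrightarrow> grad M (\<lambda>y. f (pull N \<phi> y)) y j = (\<Sum>i\<in>{i \<in> N. \<phi> i = j}. grad N f (pull N \<phi> y) i)"
    by (rule grad_eqI[OF d])
qed

lemma convex_in_cong:
  "(\<And>x. x \<in> Rvec N \<Longrightarrow> f x = g x) \<Longrightarrow> convex_in N K f \<longleftrightarrow> convex_in N K g"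
  unfolding convex_in_def by (intro ball_cong refl) (auto simp: Rvec_def)

lemma convex_in_add:
  assumes "convex_in N K f" "convex_in N K g"
  shows "convex_in N K (\<lambda>x. f x + g x)"
  unfolding convex_in_def
proof (intro ballI impI)
  fix x y t assume "x \<in> Rvec N" "y \<in> Rvec N" "t \<in> {0..1::real}" "\<forall>i\<in>N - K. x i = y i"
  with assms have "f (\<lambda>i\<in>N. (1 - t) * x i + t * y i) \<le> (1 - t) * f x + t * f y"
    "g (\<lambda>i\<in>N. (1 - t) * x i + t * y i) \<le> (1 - t) * g x + t * g y"
    unfolding convex_in_def by blast+
  then show "f (\<lambda>i\<in>N. (1 - t) * x i + t * y i) + g (\<lambda>i\<in>N. (1 - t) * x i + t * y i)
      \<le> (1 - t) * (f x + g x) + t * (f y + g y)"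
    by (simp add: algebra_simps)
qed

lemma convex_in_const [simp]: "convex_in N K (\<lambda>_. c)"
  by (simp add: convex_in_def algebra_simps)

text \<open>
  Convexity is inherited because \<open>\<phi>\<^sup>*\<close> is linear. The condition on \<open>\<phi>\<close> ensures that two points
  which differ only in coordinates from \<open>L\<close> have images that differ only in coordinates from \<open>K\<close>;
  for label-preserving maps it holds with the sets of coordinates of one label.
\<close>

lemma convex_in_pull:
  assumes f: "convex_in N K f" and \<phi>: "\<phi> \<in> N \<rightarrow> M" "\<And>i. i \<in> N \<Longrightarrow> \<phi> i \<in> L \<Longrightarrow> i \<in> K"
  shows "convex_in M L (\<lambda>y. f (pull N \<phi> y))"
  unfolding convex_in_def
proof (intro ballI impI)
  fix x y t assume *: "x \<in> Rvec M" "y \<in> Rvec M" "t \<in> {0..1::real}" "\<forall>j\<in>M - L. x j = y j"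
  have "pull N \<phi> (\<lambda>j\<in>M. (1 - t) * x j + t * y j)
      = (\<lambda>i\<in>N. (1 - t) * pull N \<phi> x i + t * pull N \<phi> y i)"
    unfolding pull_def using \<phi>(1) by (intro restrict_ext) auto
  moreover have "\<forall>i\<in>N - K. pull N \<phi> x i = pull N \<phi> y i"
    using *(4) \<phi> by (auto simp: pull_def)
  ultimately show "f (pull N \<phi> (\<lambda>j\<in>M. (1 - t) * x j + t * y j))
      \<le> (1 - t) * f (pull N \<phi> x) + t * f (pull N \<phi> y)"
    using f[unfolded convex_in_def, rule_format, of "pull N \<phi> x" "pull N \<phi> y" t] *(3) by auto
qed

section \<open>Discrete dynamical systems\<close>

lemma pull_pull: "\<phi> \<in> N \<rightarrow> M \<Longrightarrow> pull N \<phi> (pull M \<psi> y) = pull N (compose N \<psi> \<phi>) y"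
  by (auto simp: pull_def fun_eq_iff compose_def)

lemma pull_ident: "y \<in> Rvec N \<Longrightarrow> pull N (\<lambda>i\<in>N. i) y = y"
  by (auto simp: pull_def Rvec_def PiE_iff extensional_def)

lemma pull_restrict [simp]: "pull N (restrict \<phi> N) y = pull N \<phi> y"
  by (auto simp: pull_def)

text \<open>
  Addition of the increments \<open>\<upsilon> - id\<close> and \<open>\<rho> - id\<close>.
\<close>

definition dynam_add ::
  "'i set \<Rightarrow> (('i \<Rightarrow> real) \<Rightarrow> 'i \<Rightarrow> real) \<Rightarrow> (('i \<Rightarrow> real) \<Rightarrow> 'i \<Rightarrow> real) \<Rightarrow> ('i \<Rightarrow> real) \<Rightarrow> 'i \<Rightarrow> real"
  where "dynam_add N \<upsilon> \<rho> = (\<lambda>x\<in>Rvec N. \<lambda>i\<in>N. \<upsilon> x i + \<rho> x i - x i)"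

definition dynam_zero :: "'i set \<Rightarrow> ('i \<Rightarrow> real) \<Rightarrow> 'i \<Rightarrow> real" where
  "dynam_zero N = (\<lambda>x\<in>Rvec N. x)"

lemma self_map_eqI:
  assumes "\<upsilon> \<in> Rvec N \<rightarrow>\<^sub>E Rvec N" "\<rho> \<in> Rvec N \<rightarrow>\<^sub>E Rvec N"
    and "\<And>x i. \<lbrakk>x \<in> Rvec N; i \<in> N\<rbrakk> \<Longrightarrow> \<upsilon> x i = \<rho> x i"
  shows "\<upsilon> = \<rho>"
proof (rule PiE_ext[OF assms(1,2)])
  fix x assume x: "x \<in> Rvec N"
  have "\<upsilon> x \<in> Rvec N" "\<rho> x \<in> Rvec N" using assms(1,2) x by auto
  then show "\<upsilon> x = \<rho> x"
    unfolding Rvec_def using assms(3)[OF x] by (rule PiE_ext)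
qed

lemma DynamD_mem [simp]: "SetObj DynamD N = Rvec N \<rightarrow>\<^sub>E Rvec N"
  by (simp add: DynamD_def)

lemma restrict_Rvec [simp]: "restrict x N \<in> Rvec N"
  by (simp add: Rvec_def)

lemma dynam_closed [simp]:
  "dynam_add N \<upsilon> \<rho> \<in> Rvec N \<rightarrow>\<^sub>E Rvec N" "dynam_zero N \<in> Rvec N \<rightarrow>\<^sub>E Rvec N"
  "SetArr DynamD (N', \<phi>, N) \<upsilon> \<in> Rvec N \<rightarrow>\<^sub>E Rvec N"
  by (auto simp: dynam_add_def dynam_zero_def DynamD_def vadd_def)

lemma dynam_apply [simp]:
  assumes "x \<in> Rvec N" "i \<in> N"
  shows "dynam_add N \<upsilon> \<rho> x i = \<upsilon> x i + \<rho> x i - x i" "dynam_zero N x i = x i"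
  using assms by (simp_all add: dynam_add_def dynam_zero_def)

text \<open>
  In the fibre over \<open>j\<close> all coordinates of \<open>\<phi>\<^sup>* y\<close> equal \<open>y j\<close>, so this value can be subtracted
  instead of the identity.
\<close>

lemma DynamD_act:
  assumes "y \<in> Rvec M" "j \<in> M" "\<phi> \<in> N \<rightarrow> M"
  shows "SetArr DynamD (N, \<phi>, M) \<upsilon> y j
           = y j + (\<Sum>i\<in>{i \<in> N. \<phi> i = j}. \<upsilon> (pull N \<phi> y) i - y j)"
proof -
  have "(\<Sum>i\<in>{i \<in> N. \<phi> i = j}. vdiff N (\<upsilon> (pull N \<phi> y)) (pull N \<phi> y) i)
      = (\<Sum>i\<in>{i \<in> N. \<phi> i = j}. \<upsilon> (pull N \<phi> y) i - y j)"
    by (rule sum.cong) (auto simp: vdiff_def pull_def)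
  then show ?thesis
    using assms by (simp add: DynamD_def vadd_def push_def)
qed

lemma DynamD_act_ident:
  assumes "\<upsilon> \<in> Rvec N \<rightarrow>\<^sub>E Rvec N"
  shows "SetArr DynamD (N, \<lambda>i\<in>N. i, N) \<upsilon> = \<upsilon>"
proof (rule self_map_eqI[OF dynam_closed(3) assms])
  fix x i assume x: "x \<in> Rvec N" and i: "i \<in> N"
  have "{k \<in> N. restrict (\<lambda>i. i) N k = i} = {i}" using i by auto
  then show "SetArr DynamD (N, \<lambda>i\<in>N. i, N) \<upsilon> x i = \<upsilon> x i"
    using x i by (simp add: DynamD_act pull_ident del: pull_restrict)
qed

text \<open>
  Functoriality of \<open>\<phi>\<^sub>*\<close>: the fibre of a composite over \<open>k\<close> is the disjoint union of the fibres
  of \<open>\<phi>\<close> over the points of the fibre of \<open>\<psi>\<close> over \<open>k\<close>. The identity terms of the inner action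
  cancel against the difference taken by the outer one.
\<close>

lemma DynamD_act_compose:
  assumes \<phi>: "\<phi> \<in> N \<rightarrow>\<^sub>E M" and \<psi>: "\<psi> \<in> M \<rightarrow>\<^sub>E K" and fin: "finite N" "finite M"
  shows "SetArr DynamD (N, compose N \<psi> \<phi>, K) \<upsilon>
           = SetArr DynamD (M, \<psi>, K) (SetArr DynamD (N, \<phi>, M) \<upsilon>)"
proof (rule self_map_eqI[OF dynam_closed(3) dynam_closed(3)])
  fix z k assume z: "z \<in> Rvec K" and k: "k \<in> K"
  let ?w = "\<upsilon> (pull N (compose N \<psi> \<phi>) z)"
  note \<psi>\<phi> = PiE_compose[OF \<phi> \<psi>]
  have \<phi>M: "i \<in> N \<Longrightarrow> \<phi> i \<in> M" for i using \<phi> by auto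
  have "SetArr DynamD (M, \<psi>, K) (SetArr DynamD (N, \<phi>, M) \<upsilon>) z k
      = z k + (\<Sum>j\<in>{j \<in> M. \<psi> j = k}. SetArr DynamD (N, \<phi>, M) \<upsilon> (pull M \<psi> z) j - z k)"
    using z k \<psi> by (intro DynamD_act) auto
  also have "(\<Sum>j\<in>{j \<in> M. \<psi> j = k}. SetArr DynamD (N, \<phi>, M) \<upsilon> (pull M \<psi> z) j - z k)
      = (\<Sum>j\<in>{j \<in> M. \<psi> j = k}. \<Sum>i\<in>{i \<in> {i \<in> N. \<psi> (\<phi> i) = k}. \<phi> i = j}. ?w i - z k)"
  proof (rule sum.cong)
    fix j assume "j \<in> {j \<in> M. \<psi> j = k}"
    then have j: "j \<in> M" "\<psi> j = k" by auto
    have "pull N \<phi> (pull M \<psi> z) = pull N (compose N \<psi> \<phi>) z"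
      using \<phi> by (intro pull_pull) auto
    moreover have "pull M \<psi> z j = z k"
      using j by (simp add: pull_def)
    ultimately have "SetArr DynamD (N, \<phi>, M) \<upsilon> (pull M \<psi> z) j
        = z k + (\<Sum>i\<in>{i \<in> N. \<phi> i = j}. ?w i - z k)"
      using DynamD_act[of "pull M \<psi> z" M j \<phi> N \<upsilon>] j \<phi> by auto
    moreover have "{i \<in> {i \<in> N. \<psi> (\<phi> i) = k}. \<phi> i = j} = {i \<in> N. \<phi> i = j}"
      using j by auto
    ultimately show "SetArr DynamD (N, \<phi>, M) \<upsilon> (pull M \<psi> z) j - z k
        = (\<Sum>i\<in>{i \<in> {i \<in> N. \<psi> (\<phi> i) = k}. \<phi> i = j}. ?w i - z k)"
      by simp
  qed simp
  also have "\<dots> = (\<Sum>i\<in>{i \<in> N. \<psi> (\<phi> i) = k}. ?w i - z k)"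
    using fin \<phi>M by (intro sum.group) auto
  also have "{i \<in> N. \<psi> (\<phi> i) = k} = {i \<in> N. compose N \<psi> \<phi> i = k}"
    by (auto simp: compose_eq)
  also have "z k + (\<Sum>i\<in>{i \<in> N. compose N \<psi> \<phi> i = k}. ?w i - z k)
      = SetArr DynamD (N, compose N \<psi> \<phi>, K) \<upsilon> z k"
    using z k \<psi>\<phi> by (intro DynamD_act[symmetric]) auto
  finally show "SetArr DynamD (N, compose N \<psi> \<phi>, K) \<upsilon> z k
      = SetArr DynamD (M, \<psi>, K) (SetArr DynamD (N, \<phi>, M) \<upsilon>) z k" ..
qed

lemma DynamD_act_add:
  assumes \<phi>: "\<phi> \<in> N \<rightarrow>\<^sub>E M"
  shows "SetArr DynamD (N, \<phi>, M) (dynam_add N \<upsilon> \<rho>)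
           = dynam_add M (SetArr DynamD (N, \<phi>, M) \<upsilon>) (SetArr DynamD (N, \<phi>, M) \<rho>)"
proof (rule self_map_eqI[OF dynam_closed(3) dynam_closed(1)])
  fix y j assume y: "y \<in> Rvec M" and j: "j \<in> M"
  have \<phi>': "\<phi> \<in> N \<rightarrow> M" using \<phi> by auto
  have "(\<Sum>i\<in>{i \<in> N. \<phi> i = j}. dynam_add N \<upsilon> \<rho> (pull N \<phi> y) i - y j)
      = (\<Sum>i\<in>{i \<in> N. \<phi> i = j}. (\<upsilon> (pull N \<phi> y) i - y j) + (\<rho> (pull N \<phi> y) i - y j))"
    by (rule sum.cong) (auto simp: pull_def)
  also have "\<dots> = (\<Sum>i\<in>{i \<in> N. \<phi> i = j}. \<upsilon> (pull N \<phi> y) i - y j)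
      + (\<Sum>i\<in>{i \<in> N. \<phi> i = j}. \<rho> (pull N \<phi> y) i - y j)"
    by (rule sum.distrib)
  finally show "SetArr DynamD (N, \<phi>, M) (dynam_add N \<upsilon> \<rho>) y j
      = dynam_add M (SetArr DynamD (N, \<phi>, M) \<upsilon>) (SetArr DynamD (N, \<phi>, M) \<rho>) y j"
    using y j by (simp only: DynamD_act[OF y j \<phi>'] dynam_apply)
qed

lemma DynamD_act_zero:
  assumes \<phi>: "\<phi> \<in> N \<rightarrow>\<^sub>E M"
  shows "SetArr DynamD (N, \<phi>, M) (dynam_zero N) = dynam_zero M"
proof (rule self_map_eqI[OF dynam_closed(3) dynam_closed(2)])
  fix y j assume y: "y \<in> Rvec M" and j: "j \<in> M"
  have \<phi>': "\<phi> \<in> N \<rightarrow> M" using \<phi> by auto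
  have "(\<Sum>i\<in>{i \<in> N. \<phi> i = j}. dynam_zero N (pull N \<phi> y) i - y j) = 0"
    by (rule sum.neutral) (auto simp: pull_def)
  then show "SetArr DynamD (N, \<phi>, M) (dynam_zero N) y j = dynam_zero M y j"
    using y j by (simp add: DynamD_act[OF y j \<phi>'])
qed

lemma DynamD_prod_apply:
  assumes "z \<in> Rvec (coprod N M)"
  shows "i \<in> N \<Longrightarrow> ProdComparison DynamD N M (\<upsilon>, \<rho>) z (InL i) = \<upsilon> (pull N InL z) i"
    and "j \<in> M \<Longrightarrow> ProdComparison DynamD N M (\<upsilon>, \<rho>) z (InR j) = \<rho> (pull M InR z) j"
  using assms by (simp_all add: DynamD_def vadd_def push_def Collect_conv_if)

lemma DynamD_prod_comparison:
  "ProdComparison DynamD N M (\<upsilon>, \<rho>)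
     = dynam_add (coprod N M) (SetArr DynamD (FinSet_inl N M) \<upsilon>)
         (SetArr DynamD (FinSet_inr N M) \<rho>)"
proof (rule self_map_eqI)
  show "ProdComparison DynamD N M (\<upsilon>, \<rho>) \<in> Rvec (coprod N M) \<rightarrow>\<^sub>E Rvec (coprod N M)"
    by (simp add: DynamD_def vadd_def)
  fix z k assume z: "z \<in> Rvec (coprod N M)" and k: "k \<in> coprod N M"
  have fibres: "{i \<in> N. restrict InL N i = k} = {i \<in> N. InL i = k}"
    "{i \<in> M. restrict InR M i = k} = {i \<in> M. InR i = k}" by auto
  have "SetArr DynamD (FinSet_inl N M) \<upsilon> z k
      = z k + (\<Sum>i\<in>{i \<in> N. InL i = k}. \<upsilon> (pull N InL z) i - z k)"
    unfolding FinSet_inl_def using DynamD_act[OF z k, of "restrict InL N" N \<upsilon>]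
    by (simp only: fibres pull_restrict) simp
  moreover have "SetArr DynamD (FinSet_inr N M) \<rho> z k
      = z k + (\<Sum>i\<in>{i \<in> M. InR i = k}. \<rho> (pull M InR z) i - z k)"
    unfolding FinSet_inr_def using DynamD_act[OF z k, of "restrict InR M" M \<rho>]
    by (simp only: fibres pull_restrict) simp
  ultimately show "ProdComparison DynamD N M (\<upsilon>, \<rho>) z k
      = dynam_add (coprod N M) (SetArr DynamD (FinSet_inl N M) \<upsilon>)
         (SetArr DynamD (FinSet_inr N M) \<rho>) z k"
    using z by - (rule coprod_cases[OF k], simp_all add: DynamD_prod_apply Collect_conv_if)
qed simp

lemma DynamD_commutative_monoid_valued:
  "commutative_monoid_valued_functor FinSet FinSet_inl FinSet_inr DynamD dynam_add dynam_zero"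
proof -
  interpret category_with_inclusions FinSet FinSet_inl FinSet_inr
    by (rule category_with_inclusions_FinSet)
  show ?thesis
  \<comment> \<open>The cases follow the order of the assumptions of \<open>commutative_monoid_valued_functor\<close>.\<close>
  proof (unfold_locales, goal_cases)
    case 1 then show ?case by (elim hom_FinSetE) simp
  next
    case 2 then show ?case by (simp add: DynamD_act_ident)
  next
    case 3 then show ?case by (elim hom_FinSetE) (simp add: DynamD_act_compose)
  next
    case 4 show ?case by simp
  next
    case 5 show ?case by simp
  next
    case 6 show ?case by (rule self_map_eqI[OF dynam_closed(1) dynam_closed(1)]) simp
  next
    case 7 show ?case by (rule self_map_eqI[OF dynam_closed(1) dynam_closed(1)]) simp
  next
    case 8 then show ?case by - (rule self_map_eqI[OF dynam_closed(1)], simp_all)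
  next
    case 9 then show ?case by (elim hom_FinSetE) (simp add: DynamD_act_add)
  next
    case 10 then show ?case by (elim hom_FinSetE) (simp add: DynamD_act_zero)
  next
    case 11 show ?case by (simp add: DynamD_prod_comparison)
  next
    case 12 show ?case by (simp add: DynamD_def dynam_zero_def)
  qed
qed

section \<open>Differentiable saddle functions\<close>

definition fun_add ::
  "'i set \<Rightarrow> (('i \<Rightarrow> real) \<Rightarrow> real) \<Rightarrow> (('i \<Rightarrow> real) \<Rightarrow> real) \<Rightarrow> ('i \<Rightarrow> real) \<Rightarrow> real" where
  "fun_add N f g = (\<lambda>x\<in>Rvec N. f x + g x)"

definition fun_zero :: "'i set \<Rightarrow> ('i \<Rightarrow> real) \<Rightarrow> real" where
  "fun_zero N = (\<lambda>x\<in>Rvec N. 0)"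

lemma saddle_functions_iff:
  "f \<in> saddle_functions a \<longleftrightarrow> f \<in> extensional (Rvec (fst a)) \<and> C1 (fst a) f \<and>
     convex_in (fst a) {i \<in> fst a. snd a i = 1} f \<and>
     convex_in (fst a) {i \<in> fst a. snd a i = 2} (\<lambda>x. - f x)"
  by (cases a) (auto simp: saddle_functions_def concave_in_def PiE_iff)

lemma DiffSaddle_simps [simp]:
  "SetObj DiffSaddle = saddle_functions"
  "SetArr DiffSaddle (a, \<phi>, b) f = (\<lambda>y\<in>Rvec (fst b). f (pull (fst a) \<phi> y))"
  by (cases a; cases b; simp add: DiffSaddle_def)+

lemma restrict_saddle:
  assumes "C1 (fst a) h" "convex_in (fst a) {i \<in> fst a. snd a i = 1} h"
    and "convex_in (fst a) {i \<in> fst a. snd a i = 2} (\<lambda>x. - h x)"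
  shows "restrict h (Rvec (fst a)) \<in> saddle_functions a"
proof -
  let ?r = "restrict h (Rvec (fst a))"
  have "convex_in (fst a) {i \<in> fst a. snd a i = 1} ?r"
    using assms(2) by (subst convex_in_cong[where g = h]) auto
  moreover have "convex_in (fst a) {i \<in> fst a. snd a i = 2} (\<lambda>x. - ?r x)"
    using assms(3) by (subst convex_in_cong[where g = "\<lambda>x. - h x"]) auto
  ultimately show ?thesis
    using C1_restrict[OF assms(1)] by (simp add: saddle_functions_iff)
qed

lemma saddle_functions_act:
  assumes f: "f \<in> saddle_functions a" and fin: "finite (fst a)" and \<phi>: "\<phi> \<in> fst a \<rightarrow> fst b"
    and lab: "\<forall>i\<in>fst a. snd b (\<phi> i) = snd a i"
  shows "(\<lambda>y\<in>Rvec (fst b). f (pull (fst a) \<phi> y)) \<in> saddle_functions b"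
proof (rule restrict_saddle)
  show "C1 (fst b) (\<lambda>y. f (pull (fst a) \<phi> y))"
    using f fin \<phi> by (simp add: saddle_functions_iff C1_pull(1))
  show "convex_in (fst b) {i \<in> fst b. snd b i = 1} (\<lambda>y. f (pull (fst a) \<phi> y))"
    by (rule convex_in_pull[where K = "{i \<in> fst a. snd a i = 1}"])
      (use f \<phi> lab in \<open>auto simp: saddle_functions_iff\<close>)
  show "convex_in (fst b) {i \<in> fst b. snd b i = 2} (\<lambda>y. - f (pull (fst a) \<phi> y))"
    by (rule convex_in_pull[where f = "\<lambda>x. - f x" and K = "{i \<in> fst a. snd a i = 2}"])
      (use f \<phi> lab in \<open>auto simp: saddle_functions_iff\<close>)
qed

lemma saddle_functions_add:
  assumes "f \<in> saddle_functions a" "g \<in> saddle_functions a"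
  shows "fun_add (fst a) f g \<in> saddle_functions a"
  unfolding fun_add_def
proof (rule restrict_saddle)
  show "convex_in (fst a) {i \<in> fst a. snd a i = 2} (\<lambda>x. - (f x + g x))"
    using assms convex_in_add[of _ _ "\<lambda>x. - f x" "\<lambda>x. - g x"]
    by (simp add: saddle_functions_iff)
qed (use assms in \<open>simp_all add: saddle_functions_iff C1_add convex_in_add\<close>)

lemma saddle_functions_zero: "fun_zero (fst a) \<in> saddle_functions a"
  unfolding fun_zero_def by (rule restrict_saddle) (simp_all add: C1_const)

lemma Rvec_restrict_eqI:
  "\<lbrakk>f \<in> extensional (Rvec N); \<And>x. x \<in> Rvec N \<Longrightarrow> h x = f x\<rbrakk> \<Longrightarrow> restrict h (Rvec N) = f"
  by (auto simp: fun_eq_iff extensional_def)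

lemma DiffSaddle_commutative_monoid_valued:
  "commutative_monoid_valued_functor FinSet2 FinSet2_inl FinSet2_inr DiffSaddle
     (\<lambda>a. fun_add (fst a)) (\<lambda>a. fun_zero (fst a))"
proof -
  interpret category_with_inclusions FinSet2 FinSet2_inl FinSet2_inr
    by (rule category_with_inclusions_FinSet2)
  show ?thesis
  \<comment> \<open>The cases follow the order of the assumptions of \<open>commutative_monoid_valued_functor\<close>.\<close>
  proof (unfold_locales, goal_cases)
    case (1 f a b x)
    from 1(1) obtain \<phi> where "f = (a, \<phi>, b)" "a \<in> Obj FinSet2" "\<phi> \<in> fst a \<rightarrow>\<^sub>E fst b"
      "\<forall>i\<in>fst a. snd b (\<phi> i) = snd a i" by (rule hom_FinSet2E)
    then show ?case
      using saddle_functions_act[of x a \<phi> b] 1(2) by (auto simp: Obj_FinSet2)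
  next
    case 2 then show ?case
      by (auto simp: saddle_functions_iff pull_ident simp del: pull_restrict
          intro!: Rvec_restrict_eqI)
  next
    case 3 then show ?case
      by (elim hom_FinSet2E) (auto simp: pull_pull intro!: restrict_ext)
  next
    case 4 then show ?case by (simp add: saddle_functions_add)
  next
    case 5 show ?case by (simp add: saddle_functions_zero)
  next
    case 6 show ?case by (auto simp: fun_add_def intro!: restrict_ext)
  next
    case 7 show ?case by (auto simp: fun_add_def intro!: restrict_ext)
  next
    case 8 then show ?case
      by (auto simp: fun_add_def fun_zero_def saddle_functions_iff intro!: Rvec_restrict_eqI)
  next
    case 9 then show ?case
      by (elim hom_FinSet2E) (auto simp: fun_add_def intro!: restrict_ext)
  next
    case 10 then show ?case
      by (elim hom_FinSet2E) (auto simp: fun_zero_def intro!: restrict_ext)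
  next
    case (11 a b) show ?case
      by (cases a; cases b)
        (auto simp: DiffSaddle_def FinSet2_inl_def FinSet2_inr_def fun_add_def intro!: restrict_ext)
  next
    case 12 show ?case by (simp add: DiffSaddle_def fun_zero_def)
  qed
qed

section \<open>Gradient ascent-descent\<close>

definition step_sign :: "nat \<Rightarrow> real" where
  "step_sign l = (if l = 1 then - 1 else 1)"

lemma gad_closed: "gad \<gamma> a f \<in> Rvec (fst a) \<rightarrow>\<^sub>E Rvec (fst a)"
  by (cases a) (simp add: gad_def)

lemma gad_apply:
  "\<lbrakk>x \<in> Rvec (fst a); i \<in> fst a\<rbrakk>
    \<Longrightarrow> gad \<gamma> a f x i = x i + step_sign (snd a i) * \<gamma> * grad (fst a) f x i"
  by (cases a) (simp add: gad_def step_sign_def)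

text \<open>
  Naturality combines the chain rule with the fact that \<open>\<phi>\<close> preserves labels: every coordinate in
  the fibre over \<open>j\<close> is stepped with the sign of \<open>j\<close>, so the sign can be taken out of the sum
  over the fibre.
\<close>

lemma gad_natural:
  assumes f: "C1 (fst a) f" and fin: "finite (fst a)" and \<phi>: "\<phi> \<in> fst a \<rightarrow> fst b"
    and lab: "\<forall>i\<in>fst a. snd b (\<phi> i) = snd a i"
  shows "gad \<gamma> b (\<lambda>y\<in>Rvec (fst b). f (pull (fst a) \<phi> y))
           = SetArr DynamD (fst a, \<phi>, fst b) (gad \<gamma> a f)"
proof (rule self_map_eqI[OF gad_closed dynam_closed(3)])
  fix y j assume y: "y \<in> Rvec (fst b)" and j: "j \<in> fst b"
  let ?x = "pull (fst a) \<phi> y" and ?I = "{i \<in> fst a. \<phi> i = j}"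
  let ?s = "step_sign (snd b j) * \<gamma>"
  have "gad \<gamma> b (\<lambda>y\<in>Rvec (fst b). f (pull (fst a) \<phi> y)) y j
      = y j + ?s * (\<Sum>i\<in>?I. grad (fst a) f ?x i)"
    using y j by (simp add: gad_apply grad_restrict C1_pull(2)[OF f fin \<phi>])
  also have "?s * (\<Sum>i\<in>?I. grad (fst a) f ?x i) = (\<Sum>i\<in>?I. gad \<gamma> a f ?x i - y j)"
    unfolding sum_distrib_left
  proof (rule sum.cong)
    fix i assume "i \<in> ?I"
    then have "i \<in> fst a" "?x i = y j" "snd a i = snd b j" using lab by (auto simp: pull_def)
    then show "?s * grad (fst a) f ?x i = gad \<gamma> a f ?x i - y j"
      by (simp add: gad_apply)
  qed simp
  also have "y j + \<dots> = SetArr DynamD (fst a, \<phi>, fst b) (gad \<gamma> a f) y j"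
    by (rule DynamD_act[OF y j \<phi>, symmetric])
  finally show "gad \<gamma> b (\<lambda>y\<in>Rvec (fst b). f (pull (fst a) \<phi> y)) y j
      = SetArr DynamD (fst a, \<phi>, fst b) (gad \<gamma> a f) y j" .
qed

text \<open>
  Linearity of the gradient: the increments of the two steps add up.
\<close>

lemma gad_add:
  assumes "C1 (fst a) f" "C1 (fst a) g"
  shows "gad \<gamma> a (fun_add (fst a) f g) = dynam_add (fst a) (gad \<gamma> a f) (gad \<gamma> a g)"
  by (rule self_map_eqI[OF gad_closed dynam_closed(1)])
    (simp add: gad_apply fun_add_def grad_restrict C1_add(2)[OF assms] algebra_simps)

lemma gad_zero: "gad \<gamma> a (fun_zero (fst a)) = dynam_zero (fst a)"
  by (rule self_map_eqI[OF gad_closed dynam_closed(2)])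
    (simp add: gad_apply fun_zero_def grad_restrict grad_const)

theorem corollary4p4p1:
  fixes \<gamma> :: real
  assumes "\<gamma> > 0"
  shows "strict_symmetric_monoidal_functor
             (FinSet2 :: ('a labelled, 'a labelled_arr) smcat)
             (FinSet :: ('a finset, 'a finset_arr) smcat) Forget
       \<and> lax_symmetric_monoidal_functor (FinSet :: ('a finset, 'a finset_arr) smcat) DynamD
       \<and> monoidal_natural_transformation
             (FinSet2 :: ('a labelled, 'a labelled_arr) smcat)
             DiffSaddle (precompose DynamD Forget) (gad \<gamma>)"
proof (intro conjI)
  show "strict_symmetric_monoidal_functor
      (FinSet2 :: ('a labelled, 'a labelled_arr) smcat) FinSet Forget"
    by (rule strict_symmetric_monoidal_functor_Forget)
  interpret D: commutative_monoid_valued_functor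
    "FinSet :: ('a finset, 'a finset_arr) smcat" FinSet_inl FinSet_inr DynamD dynam_add dynam_zero
    by (rule DynamD_commutative_monoid_valued)
  show "lax_symmetric_monoidal_functor (FinSet :: ('a finset, 'a finset_arr) smcat) DynamD"
    by (rule D.lax_symmetric_monoidal_functor_axioms)
  show "monoidal_natural_transformation
      (FinSet2 :: ('a labelled, 'a labelled_arr) smcat)
      DiffSaddle (precompose DynamD Forget) (gad \<gamma>)"
  proof (rule monoidal_natural_transformationI[OF DiffSaddle_commutative_monoid_valued
        commutative_monoid_valued_functor_precompose[OF strict_symmetric_monoidal_functor_Forget
          category_with_inclusions_FinSet2 DynamD_commutative_monoid_valued Forget_inclusions]])
    fix h :: "'a labelled_arr" and a b f
    assume "h \<in> hom FinSet2 a b" and f: "f \<in> SetObj DiffSaddle a"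
    from this(1) obtain \<phi> where "h = (a, \<phi>, b)" "a \<in> Obj FinSet2" "\<phi> \<in> fst a \<rightarrow>\<^sub>E fst b"
      "\<forall>i\<in>fst a. snd b (\<phi> i) = snd a i" by (rule hom_FinSet2E)
    then show "gad \<gamma> b (SetArr DiffSaddle h f) = SetArr (precompose DynamD Forget) h (gad \<gamma> a f)"
      using f gad_natural[of a f \<phi> b \<gamma>]
      by (auto simp: precompose_def Obj_FinSet2 saddle_functions_iff)
  qed (simp_all add: precompose_def gad_closed gad_add saddle_functions_iff
      gad_zero[of \<gamma> labelled_empty, simplified])
qed

end
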